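(* There is a real constant $c$ with $0<c<1$ such that for every prime power $q$ and every integer $n\geq 1$, the proportion of $f$-cyclic matrices in $\mathrm{M}(n,q)$ is at least $1-c^n$. (The constant $c=0.983$ suffices.)
   Context: For a prime power $q$, $\mathrm{M}(n,q)$ denotes the algebra of all $n\times n$ matrices over the finite field $\mathbb{F}_q$. For $X\in\mathrm{M}(n,q)$ let $V=\mathbb{F}_q^{1\times n}$ be regarded as an $\mathbb{F}_q[t]$-module with $t$ acting as $X$. For a monic irreducible $g\in\mathbb{F}_q[t]$, the $g$-primary component of $V$ is $V(g)=\ker g(X)^n$. The matrix $X$ is called $f$-cyclic if there exists a monic irreducible divisor $g$ of the characteristic polynomial $c_X(t)$ such that $V(g)$ is a cyclic $\mathbb{F}_q[X]$-module (generated by a single vector). *)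

theory Defs
  imports "Jordan_Normal_Form.Char_Poly" "HOL-Computational_Algebra.Polynomial_Factorial"
begin

(* Row vector v (of dimension dim_row X) times matrix X, i.e. the action v \<mapsto> v X of t on V = F^{1 x n} *)
definition row_mult :: "'a :: comm_ring_1 vec \<Rightarrow> 'a mat \<Rightarrow> 'a vec" where
  "row_mult v X = vec (dim_col X) (\<lambda>j. \<Sum>i<dim_row X. v $ i * X $$ (i, j))"

fun horner_mat :: "nat \<Rightarrow> 'a :: comm_ring_1 mat \<Rightarrow> 'a list \<Rightarrow> 'a mat" where
  "horner_mat n X [] = 0\<^sub>m n n"
| "horner_mat n X (c # cs) = c \<cdot>\<^sub>m 1\<^sub>m n + X * horner_mat n X cs"

definition poly_mat :: "'a :: comm_ring_1 poly \<Rightarrow> 'a mat \<Rightarrow> 'a mat" where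
  "poly_mat p X = horner_mat (dim_row X) X (coeffs p)"

definition primary_component :: "'a :: field mat \<Rightarrow> 'a poly \<Rightarrow> 'a vec set" where
  "primary_component X g =
     {v \<in> carrier_vec (dim_row X). row_mult v (poly_mat (g ^ dim_row X) X) = 0\<^sub>v (dim_row X)}"

definition cyclic_submodule :: "'a :: field mat \<Rightarrow> 'a vec set \<Rightarrow> bool" where
  "cyclic_submodule X W \<longleftrightarrow> (\<exists>w \<in> W. W = {row_mult w (poly_mat p X) | p. True})"

definition f_cyclic :: "'a :: field mat \<Rightarrow> bool" where
  "f_cyclic X \<longleftrightarrow> (\<exists>g. monic g \<and> irreducible g \<and> g dvd char_poly X
                        \<and> cyclic_submodule X (primary_component X g))"

end

theory Submission
  imports Defs "HOL-Library.Cardinality" "HOL-Library.FuncSet"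
begin

text \<open>If an irreducible \<open>g\<close> divides \<open>c\<^sub>X\<close> exactly once, then \<open>V(g)\<close> is cyclic. Hence the characteristic
  polynomial of a matrix that is not \<open>f\<close>-cyclic is powerful: each of its irreducible factors occurs
  at least twice. Let \<open>k\<close> be the dimension of the cyclic subspace generated by the first
  unit vector \<open>w\<close>. Given \<open>w, w X, \<dots>, w X\<^sup>k\<^sup>-\<^sup>1\<close>, the matrix is determined by the minimal polynomial \<open>f\<close> of \<open>w\<close>,
  the matrix \<open>Y\<close> induced on the quotient space, and an off-diagonal block, and \<open>c\<^sub>X = f c\<^sub>Y\<close>. So the
  proportion of bad matrices is at most \<open>q\<^sup>-\<^sup>n\<close> times the sum over \<open>j < n\<close> of the maximal number of monic
  \<open>f\<close> of degree \<open>n - j\<close> such that \<open>f h\<close> is powerful, for \<open>h\<close> of degree \<open>j\<close>. A powerful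
  polynomial has the form \<open>a\<^sup>2 b\<^sup>3\<close>, so for \<open>h = 1\<close> there are at most \<open>2 y\<^sup>n\<close> of these, where \<open>y = \<surd>q\<close>;
  each irreducible factor of \<open>h\<close> of degree \<open>d\<close> costs a factor of at most \<open>1 + y\<^sup>-\<^sup>d\<close>. The resulting
  geometric sum is small enough for \<open>n \<ge> 17\<close>; for smaller \<open>n\<close> only the terms \<open>j = 0, 1\<close> are
  estimated in this way and the others trivially by \<open>q\<^sup>n\<^sup>-\<^sup>j\<close>.\<close>

subsection \<open>Powerful polynomials\<close>

definition monics :: "nat \<Rightarrow> 'a :: field poly set" where
  "monics k = {f. monic f \<and> degree f = k}"

text \<open>Irreducible factors shared with \<open>h\<close> are exempt and may occur just once in
  \<open>f\<close>. For \<open>h = 1\<close> this is ordinary powerfulness, since no irreducible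
  divides 1.\<close>

definition powerful_off :: "'a :: field poly \<Rightarrow> 'a poly \<Rightarrow> bool" where
  "powerful_off h f \<longleftrightarrow> (\<forall>p. irreducible p \<longrightarrow> p dvd f \<longrightarrow> p ^ 2 dvd f \<or> p dvd h)"

lemma powerful_offD:
  "powerful_off h f \<Longrightarrow> irreducible p \<Longrightarrow> p dvd f \<Longrightarrow> p ^ 2 dvd f \<or> p dvd h"
  by (auto simp: powerful_off_def)

lemma monics_subset_image:
  "monics k \<subseteq> (\<lambda>xs. Poly (xs @ [1])) ` {xs :: 'a :: field list. set xs \<subseteq> UNIV \<and> length xs = k}"
proof
  fix f :: "'a poly" assume f: "f \<in> monics k"
  hence f0: "f \<noteq> 0" and m: "monic f" and d: "degree f = k" by (auto simp: monics_def)
  have "coeffs f \<noteq> []" using f0 by simp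
  moreover have "last (coeffs f) = 1" using f0 m by (simp add: last_coeffs_eq_coeff_degree)
  ultimately have "coeffs f = butlast (coeffs f) @ [1]" by (metis append_butlast_last_id)
  hence "f = Poly (butlast (coeffs f) @ [1])" by (metis Poly_coeffs)
  moreover have "length (butlast (coeffs f)) = k" using f0 d by (simp add: length_coeffs_degree)
  ultimately show "f \<in> (\<lambda>xs. Poly (xs @ [1])) ` {xs. set xs \<subseteq> UNIV \<and> length xs = k}" by blast
qed

lemma finite_monics: "finite (monics k :: 'a :: {finite, field} poly set)"
  by (rule finite_subset[OF monics_subset_image]) (intro finite_imageI finite_lists_length_eq finite)

lemma card_monics_le: "card (monics k :: 'a :: {finite, field} poly set) \<le> CARD('a) ^ k"
proof -
  have fin: "finite {xs :: 'a list. set xs \<subseteq> UNIV \<and> length xs = k}"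
    by (intro finite_lists_length_eq finite)
  have "card (monics k :: 'a poly set)
      \<le> card ((\<lambda>xs. Poly (xs @ [1])) ` {xs :: 'a list. set xs \<subseteq> UNIV \<and> length xs = k})"
    by (rule card_mono[OF finite_imageI[OF fin] monics_subset_image])
  also have "\<dots> \<le> card {xs :: 'a list. set xs \<subseteq> UNIV \<and> length xs = k}"
    by (rule card_image_le[OF fin])
  finally show ?thesis using card_lists_length_eq[OF finite[of "UNIV :: 'a set"], of k] by simp
qed

section \<open>Monic irreducible factors and the decomposition of powerful polynomials\<close>

lemma monic_mult_iff:
  fixes f g :: "'a :: field poly"
  assumes "monic f" shows "monic (f * g) \<longleftrightarrow> monic g"
  using assms by (simp add: lead_coeff_mult)

text \<open>A monic nonconstant divisor of least degree is irreducible: a nonconstant proper factor,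
  made monic, would be a smaller candidate.\<close>

lemma ex_monic_irreducible_dvd:
  fixes f :: "'a :: field poly"
  assumes "degree f > 0"
  obtains p where "irreducible p" "monic p" "p dvd f"
proof -
  let ?P = "\<lambda>p. monic p \<and> degree p > 0 \<and> p dvd f"
  have "?P (Polynomial.smult (inverse (lead_coeff f)) f)" using assms by (auto simp: smult_dvd_iff)
  then obtain p where p: "?P p" and min: "\<And>r. ?P r \<Longrightarrow> degree p \<le> degree r"
    using ex_has_least_nat[of ?P _ degree] by blast
  have "irreducible p"
  proof (rule irreducibleI)
    show "p \<noteq> 0" using p by auto
    show "\<not> p dvd 1" using p by (auto simp: poly_dvd_1)
    fix a b assume ab: "p = a * b"
    show "a dvd 1 \<or> b dvd 1"
    proof (rule ccontr)
      assume n: "\<not> (a dvd 1 \<or> b dvd 1)"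
      have nz: "a \<noteq> 0" "b \<noteq> 0" using \<open>p \<noteq> 0\<close> ab by auto
      hence pos: "degree a > 0" "degree b > 0"
        using n by (auto simp: is_unit_iff_degree)
      have "?P (Polynomial.smult (inverse (lead_coeff a)) a)"
        using nz pos p ab by (auto simp: smult_dvd_iff intro: dvd_trans[of a "a * b" f])
      from min[OF this] have "degree p \<le> degree a" using nz by simp
      thus False using ab nz pos by (simp add: degree_mult_eq)
    qed
  qed
  thus ?thesis using p that by blast
qed

lemma prime_elem_decompose:
  fixes f :: "'a :: field poly"
  assumes p: "prime_elem p" and f: "f \<noteq> 0"
  obtains e f' where "f = p ^ e * f'" "\<not> p dvd f'"
proof -
  have dp: "degree p > 0" using p by (auto simp: prime_elem_def is_unit_iff_degree)
  have "f \<noteq> 0 \<Longrightarrow> \<exists>e f'. f = p ^ e * f' \<and> \<not> p dvd f'"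
  proof (induction "degree f" arbitrary: f rule: less_induct)
    case less
    show ?case
    proof (cases "p dvd f")
      case False
      thus ?thesis by (intro exI[of _ 0] exI[of _ f]) auto
    next
      case True
      then obtain g where g: "f = p * g" unfolding dvd_def by blast
      with less.prems have "g \<noteq> 0" "p \<noteq> 0" by auto
      hence "degree g < degree f" using dp g by (simp add: degree_mult_eq)
      then obtain e f' where "g = p ^ e * f'" "\<not> p dvd f'" using less.hyps \<open>g \<noteq> 0\<close> by blast
      thus ?thesis using g by (intro exI[of _ "Suc e"] exI[of _ f']) (auto simp: mult.assoc)
    qed
  qed
  thus ?thesis using f that by blast
qed

lemma prime_elem_square_dvd_multD:
  fixes p :: "'a :: idom"
  assumes p: "prime_elem p" and d: "p ^ 2 dvd a * b" and n: "\<not> p dvd a"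
  shows "p ^ 2 dvd b"
proof -
  have p0: "p \<noteq> 0" using p by auto
  have "p dvd a * b" using d by (meson dvd_power dvd_trans pos2)
  hence "p dvd b" using p n by (simp add: prime_elem_dvd_mult_iff)
  then obtain c where c: "b = p * c" unfolding dvd_def by blast
  have "p * p dvd p * (a * c)" using d c by (simp add: power2_eq_square algebra_simps)
  hence "p dvd a * c" using p0 by (metis dvd_mult_cancel_left)
  hence "p dvd c" using p n by (simp add: prime_elem_dvd_mult_iff)
  thus ?thesis using c by (auto simp: power2_eq_square)
qed

lemma irreducible_dvd_irreducible:
  fixes p r :: "'a :: field poly"
  assumes "irreducible p" "irreducible r" "r dvd p" shows "p dvd r"
proof -
  obtain c where c: "p = r * c" using assms(3) unfolding dvd_def by blast
  hence "c dvd 1" using irreducibleD[OF assms(1) c] assms(2) by (auto simp: irreducible_def)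
  then obtain d where "c * d = 1" unfolding dvd_def by metis
  hence "r = p * d" using c by (simp add: mult.assoc)
  thus ?thesis by simp
qed

text \<open>Every exponent \<open>e >= 2\<close> is \<open>2 i\<close> or \<open>2 i + 3\<close>, so
  \<open>p ^ e\<close> contributes \<open>p ^ i\<close> to \<open>a\<close> and, for odd
  \<open>e\<close>, one \<open>p\<close> to \<open>b\<close>. The induction strips off the full
  power of one irreducible at a time.\<close>

lemma powerful_decompose:
  fixes f :: "'a :: field poly"
  assumes "monic f" "powerful_off 1 f"
  shows "\<exists>a b. monic a \<and> monic b \<and> f = a ^ 2 * b ^ 3"
  using assms
proof (induction "degree f" arbitrary: f rule: less_induct)
  case less
  show ?case
  proof (cases "degree f = 0")
    case True
    hence "f = 1" using less.prems(1) using monic_degree_0 by blast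
    thus ?thesis by (intro exI[of _ 1]) simp
  next
    case False
    then obtain p where p: "irreducible p" "monic p" "p dvd f"
      using ex_monic_irreducible_dvd by blast
    have pr: "prime_elem p" using p field_poly_irreducible_imp_prime by blast
    have f0: "f \<noteq> 0" using False by auto
    obtain e f' where e: "f = p ^ e * f'" "\<not> p dvd f'"
      using prime_elem_decompose[OF pr f0] by blast
    have "e \<noteq> 0" using e p(3) by (cases e) auto
    moreover have "e \<noteq> 1"
    proof
      assume "e = 1"
      have "p ^ 2 dvd f"
        using powerful_offD[OF less.prems(2) p(1,3)] p(1) by (auto simp: irreducible_def)
      hence "p * p dvd p * f'" using e \<open>e = 1\<close> by (simp add: power2_eq_square)
      thus False using e(2) p(1) by (metis dvd_mult_cancel_left irreducible_def)
    qed
    ultimately have e2: "e \<ge> 2" by simp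
    have dp: "degree p > 0" using p by (auto simp: irreducible_def is_unit_iff_degree)
    have mpe: "monic (p ^ e)" using p(2) by (simp add: lead_coeff_power)
    have mf': "monic f'" using monic_mult_iff[OF mpe, of f'] e(1) less.prems(1) by simp
    have "degree f = e * degree p + degree f'"
      using e(1) f0 by (cases "p = 0") (auto simp: degree_mult_eq degree_power_eq)
    hence lt: "degree f' < degree f" using dp e2 by simp
    \<comment> \<open>An irreducible factor of \<open>f'\<close> cannot divide \<open>p\<close>, so
      its square, which divides \<open>f\<close>, must divide \<open>f'\<close>.\<close>
    have "powerful_off 1 f'"
      unfolding powerful_off_def
    proof (intro allI impI)
      fix r assume r: "irreducible r" "r dvd f'"
      have rp: "prime_elem r" using r field_poly_irreducible_imp_prime by blast
      have "\<not> r dvd p"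
        using irreducible_dvd_irreducible[OF p(1) r(1)] r(2) e(2) dvd_trans by blast
      hence nr: "\<not> r dvd p ^ e" using prime_elem_dvd_power[OF rp] by blast
      have "r dvd f" using r(2) e(1) by simp
      hence "r ^ 2 dvd p ^ e * f'"
        using powerful_offD[OF less.prems(2) r(1)] r(1) e(1) by (auto simp: irreducible_def)
      thus "r ^ 2 dvd f' \<or> r dvd 1" using prime_elem_square_dvd_multD[OF rp _ nr] by blast
    qed
    then obtain a b where ab: "monic a" "monic b" "f' = a ^ 2 * b ^ 3"
      using less.hyps[OF lt mf'] by blast
    show ?thesis
    proof (cases "even e")
      case True
      then obtain i where i: "e = 2 * i" by blast
      have "f = (p ^ i * a) ^ 2 * b ^ 3"
        using e(1) ab(3) i by (simp add: power_mult_distrib power_mult[symmetric] mult_ac)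
      moreover have "monic (p ^ i * a)" using p(2) ab(1) by (simp add: lead_coeff_mult lead_coeff_power)
      ultimately show ?thesis using ab(2) by blast
    next
      case False
      then obtain i where i: "e = 2 * i + 3"
      proof -
        have "e \<ge> 3" "even (e - 3)" using e2 False by (presburger, presburger)
        thus thesis using that by (metis evenE le_add_diff_inverse2)
      qed
      have "f = (p ^ i * a) ^ 2 * (p * b) ^ 3"
        using e(1) ab(3) i by (simp add: power_mult_distrib power_add power_mult[symmetric] mult_ac)
      moreover have "monic (p ^ i * a)" "monic (p * b)"
        using p(2) ab(1,2) by (simp_all add: lead_coeff_mult lead_coeff_power)
      ultimately show ?thesis by blast
    qed
  qed
qed

text \<open>The number of monic pairs \<open>(a, b)\<close> over a field of size \<open>q\<close>
  with \<open>2 * degree a + 3 * degree b = k\<close>, that is, the coefficient of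
  \<open>t^k\<close> in \<open>1 / ((1 - q t^2) (1 - q t^3))\<close>. The recursion splits off the
  pairs with \<open>b = 1\<close>; lowering the degree of \<open>b\<close> by one accounts for the
  factor \<open>q\<close>.\<close>

fun powerful_bound :: "nat \<Rightarrow> nat \<Rightarrow> nat" where
  "powerful_bound q 0 = 1"
| "powerful_bound q (Suc 0) = 0"
| "powerful_bound q (Suc (Suc 0)) = q"
| "powerful_bound q (Suc (Suc (Suc k))) = (if odd k then q ^ ((k + 3) div 2) else 0) + q * powerful_bound q k"

lemma powerful_bound_eq_sum:
  "powerful_bound q k = (\<Sum>l\<le>k. if 3 * l \<le> k \<and> even (k - l) then q ^ ((k - 3 * l) div 2 + l) else 0)"
proof (induction q k rule: powerful_bound.induct)
  case (4 q k)
  let ?t = "\<lambda>k l. if 3 * l \<le> k \<and> even (k - l) then q ^ ((k - 3 * l) div 2 + l) else 0"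
  have "(\<Sum>l\<le>Suc (Suc (Suc k)). ?t (Suc (Suc (Suc k))) l)
      = ?t (Suc (Suc (Suc k))) 0 + (\<Sum>l\<le>Suc (Suc k). ?t (Suc (Suc (Suc k))) (Suc l))"
    by (rule sum.atMost_Suc_shift)
  also have "(\<Sum>l\<le>Suc (Suc k). ?t (Suc (Suc (Suc k))) (Suc l)) = (\<Sum>l\<le>Suc (Suc k). q * ?t k l)"
  proof (rule sum.cong[OF refl])
    fix l assume "l \<in> {..Suc (Suc k)}"
    have "3 * Suc l \<le> Suc (Suc (Suc k)) \<longleftrightarrow> 3 * l \<le> k" by auto
    moreover have "even (Suc (Suc (Suc k)) - Suc l) \<longleftrightarrow> even (k - l)" if "3 * l \<le> k"
      using that by (simp add: Suc_diff_le)
    moreover have "Suc (Suc (Suc k)) - 3 * Suc l = k - 3 * l" by auto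
    ultimately show "?t (Suc (Suc (Suc k))) (Suc l) = q * ?t k l" by auto
  qed
  also have "(\<Sum>l\<le>Suc (Suc k). q * ?t k l) = q * (\<Sum>l\<le>k. ?t k l)"
    by (simp add: sum_distrib_left)
  finally show ?case using 4 by (simp add: numeral_3_eq_3)
qed (auto simp: atMost_Suc)

text \<open>Going from \<open>k\<close> to \<open>k + 3\<close> raises \<open>k div 2\<close> by one
  for even \<open>k\<close>, where everything scales by \<open>q\<close>, and by two for odd
  \<open>k\<close>, where the spare factor \<open>q >= 2\<close> pays for the additional
  term.\<close>

lemma powerful_bound_le:
  assumes "q \<ge> 2"
  shows "powerful_bound q k \<le> 2 * q ^ (k div 2)"
  using assms
proof (induction q k rule: powerful_bound.induct)
  case (4 q k)
  have IH: "q * powerful_bound q k \<le> q * (2 * q ^ (k div 2))" using 4 by simp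
  show ?case
  proof (cases "odd k")
    case False
    hence "Suc (Suc (Suc k)) div 2 = Suc (k div 2)" by (auto elim!: evenE)
    thus ?thesis using IH False by (simp add: mult_ac)
  next
    case True
    hence e: "(k + 3) div 2 = Suc (Suc (k div 2))" by (auto elim!: oddE)
    have "2 * q ^ (k div 2) \<le> q * q ^ (k div 2)" using 4(2) by (intro mult_right_mono) auto
    moreover have "powerful_bound q k \<le> 2 * q ^ (k div 2)" using 4 by simp
    ultimately have "powerful_bound q k \<le> q * q ^ (k div 2)" by linarith
    thus ?thesis using True e by (simp add: mult_ac numeral_3_eq_3)
  qed
qed auto


section \<open>Counting polynomials that are powerful off a given polynomial\<close>

definition powerful_count :: "nat \<Rightarrow> 'a :: field poly \<Rightarrow> nat" where
  "powerful_count k h = card {f \<in> monics k. powerful_off h f}"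

lemma powerful_count_le_power: "powerful_count k (h :: 'a :: {finite, field} poly) \<le> CARD('a) ^ k"
  unfolding powerful_count_def
  by (rule order_trans[OF card_mono[OF finite_monics] card_monics_le]) auto

lemma powerful_count_mono:
  fixes h h' :: "'a :: {finite, field} poly"
  assumes "\<And>f. f \<in> monics k \<Longrightarrow> powerful_off h f \<Longrightarrow> powerful_off h' f"
  shows "powerful_count k h \<le> powerful_count k h'"
  unfolding powerful_count_def using assms by (intro card_mono) (auto simp: finite_monics)

text \<open>Powerful monic polynomials are covered by the products \<open>a ^ 2 * b ^ 3\<close>,
  grouped by \<open>l = degree b\<close>. Such products may coincide, which is harmless for an upper
  bound.\<close>

lemma powerful_count_one_le:
  "powerful_count k (1 :: 'a :: {finite, field} poly) \<le> powerful_bound CARD('a) k"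
proof -
  let ?L = "{l. l \<le> k \<and> 3 * l \<le> k \<and> even (k - l)}"
  let ?S = "\<lambda>l. monics ((k - 3 * l) div 2) \<times> monics l :: ('a poly \<times> 'a poly) set"
  let ?g = "\<lambda>(a, b). a ^ 2 * b ^ 3 :: 'a poly"
  have sub: "{f :: 'a poly. f \<in> monics k \<and> powerful_off 1 f} \<subseteq> (\<Union>l\<in>?L. ?g ` ?S l)"
  proof
    fix f :: "'a poly" assume "f \<in> {f. f \<in> monics k \<and> powerful_off 1 f}"
    then obtain a b where ab: "monic a" "monic b" "f = a ^ 2 * b ^ 3" and d: "degree f = k"
      using powerful_decompose[of f] by (auto simp: monics_def)
    have "a \<noteq> 0" "b \<noteq> 0" using ab by auto
    hence k: "k = 2 * degree a + 3 * degree b"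
      using ab(3) d by (simp add: degree_mult_eq degree_power_eq)
    hence "degree b \<in> ?L" by auto
    moreover have "(a, b) \<in> ?S (degree b)" using ab k by (auto simp: monics_def)
    moreover have "f = ?g (a, b)" using ab(3) by simp
    ultimately show "f \<in> (\<Union>l\<in>?L. ?g ` ?S l)" by (intro UN_I image_eqI)
  qed
  have "finite (\<Union>l\<in>?L. ?g ` ?S l)" by (simp add: finite_monics)
  from card_mono[OF this sub] have "powerful_count k (1 :: 'a poly) \<le> card (\<Union>l\<in>?L. ?g ` ?S l)"
    unfolding powerful_count_def .
  also have "\<dots> \<le> (\<Sum>l\<in>?L. card (?g ` ?S l))" by (rule card_UN_le) auto
  also have "\<dots> \<le> (\<Sum>l\<in>?L. CARD('a) ^ ((k - 3 * l) div 2 + l))"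
  proof (rule sum_mono)
    fix l
    have "card (?g ` ?S l) \<le> card (?S l)" by (rule card_image_le) (auto simp: finite_monics)
    also have "\<dots> \<le> CARD('a) ^ ((k - 3 * l) div 2) * CARD('a) ^ l"
      unfolding card_cartesian_product by (intro mult_mono card_monics_le) auto
    finally show "card (?g ` ?S l) \<le> CARD('a) ^ ((k - 3 * l) div 2 + l)" by (simp add: power_add)
  qed
  also have "\<dots> = powerful_bound CARD('a) k"
    unfolding powerful_bound_eq_sum by (rule sum.mono_neutral_cong_left) auto
  finally show ?thesis .
qed

text \<open>If \<open>p\<close> divides \<open>f\<close> exactly once, then \<open>f / p\<close> is prime to \<open>p\<close> and again powerful off \<open>h\<close>.\<close>

lemma powerful_count_mult_irreducible:
  fixes h p :: "'a :: {finite, field} poly"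
  assumes p: "irreducible p" "monic p"
  shows "powerful_count k (p * h)
    \<le> powerful_count k h + (if degree p \<le> k then powerful_count (k - degree p) h else 0)"
proof -
  have pr: "prime_elem p" using p field_poly_irreducible_imp_prime by blast
  let ?A = "{f \<in> monics k. powerful_off h f}"
  let ?B = "if degree p \<le> k then (\<lambda>f. p * f) ` {f \<in> monics (k - degree p). powerful_off h f} else {}"
  have "{f \<in> monics k. powerful_off (p * h) f} \<subseteq> ?A \<union> ?B"
  proof
    fix f assume f: "f \<in> {f \<in> monics k. powerful_off (p * h) f}"
    hence f0: "f \<noteq> 0" and fd: "degree f = k" and fm: "monic f" and fp: "powerful_off (p * h) f"
      by (auto simp: monics_def)
    \<comment> \<open>For factors that do not divide \<open>p\<close>, being exempt through
      \<open>p * h\<close> means being exempt through \<open>h\<close>.\<close>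
    have other: "r ^ 2 dvd f \<or> r dvd h" if r: "irreducible r" "r dvd f" "\<not> r dvd p" for r
      using powerful_offD[OF fp r(1,2)] r(3)
      by (simp add: prime_elem_dvd_mult_iff[OF field_poly_irreducible_imp_prime[OF r(1)]])
    show "f \<in> ?A \<union> ?B"
    proof (cases "p dvd f \<and> \<not> p ^ 2 dvd f")
      \<comment> \<open>Here \<open>p\<close> divides \<open>f\<close> either not at all or at least
        twice, so factors associate to \<open>p\<close> meet the condition too.\<close>
      case False
      have "powerful_off h f"
        unfolding powerful_off_def
      proof (intro allI impI)
        fix r assume r: "irreducible r" "r dvd f"
        show "r ^ 2 dvd f \<or> r dvd h"
        proof (cases "r dvd p")
          case True
          hence "p dvd r" using irreducible_dvd_irreducible[OF p(1) r(1)] by blast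
          hence "p dvd f" using r(2) dvd_trans by blast
          hence "p ^ 2 dvd f" using False by blast
          thus ?thesis using dvd_trans[OF dvd_power_same[OF True]] by simp
        qed (rule other[OF r])
      qed
      thus ?thesis using f by blast
    next
      case True
      then obtain g where g: "f = p * g" unfolding dvd_def by blast
      hence ng: "\<not> p dvd g" using True by (auto simp: power2_eq_square)
      have gm: "monic g" using monic_mult_iff[OF p(2)] fm g by metis
      have dk: "k = degree p + degree g" using g fd f0 by (simp add: degree_mult_eq)
      have "powerful_off h g"
        unfolding powerful_off_def
      proof (intro allI impI)
        fix r assume r: "irreducible r" "r dvd g"
        have rp: "\<not> r dvd p" using irreducible_dvd_irreducible[OF p(1) r(1)] r(2) ng dvd_trans by blast
        have "r dvd f" using r(2) g by simp
        hence "r ^ 2 dvd p * g \<or> r dvd h" using other[OF r(1) _ rp] g by blast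
        thus "r ^ 2 dvd g \<or> r dvd h"
          using prime_elem_square_dvd_multD[OF field_poly_irreducible_imp_prime[OF r(1)] _ rp] by blast
      qed
      hence "g \<in> {f \<in> monics (k - degree p). powerful_off h f}" using gm dk by (auto simp: monics_def)
      thus ?thesis using dk g by auto
    qed
  qed
  hence "powerful_count k (p * h) \<le> card (?A \<union> ?B)"
    unfolding powerful_count_def by (intro card_mono) (auto simp: finite_monics)
  also have "\<dots> \<le> card ?A + card ?B" by (rule card_Un_le)
  also have "card ?B \<le> (if degree p \<le> k then powerful_count (k - degree p) h else 0)"
    by (auto simp: powerful_count_def finite_monics intro!: card_image_le)
  finally show ?thesis by (simp add: powerful_count_def)
qed

lemma powerful_count_unit:
  fixes h :: "'a :: {finite, field} poly"
  assumes "h dvd 1" shows "powerful_count k h \<le> powerful_count k (1 :: 'a poly)"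
proof (rule powerful_count_mono)
  fix f assume "powerful_off h f"
  thus "powerful_off 1 f" unfolding powerful_off_def using dvd_trans[OF _ assms] by metis
qed

text \<open>Removing from \<open>h\<close> an irreducible factor of degree \<open>d\<close> costs a
  factor \<open>1 + (1 / y) ^ d\<close>, which is at most \<open>(1 + 1 / y) ^ d\<close>. The bound
  thus depends on \<open>h\<close> only through its degree. The induction keeps \<open>k\<close>
  arbitrary because the count at \<open>k - d\<close> enters.\<close>

lemma powerful_count_le:
  fixes h :: "'a :: {finite, field} poly"
  assumes "h \<noteq> 0" and y: "y \<ge> 1" "y ^ 2 = real CARD('a)"
  shows "real (powerful_count k h) \<le> 2 * y ^ k * (1 + 1 / y) ^ degree h"
  using assms(1)
proof (induction "degree h" arbitrary: h k rule: less_induct)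
  case less
  have q2: "CARD('a) \<ge> 2" using card_mono[of "UNIV :: 'a set" "{0, 1}"] by simp
  show ?case
  proof (cases "degree h = 0")
    case True
    hence "h dvd 1" using less.prems by (simp add: is_unit_iff_degree)
    hence "powerful_count k h \<le> 2 * CARD('a) ^ (k div 2)"
      using powerful_count_unit[of h k] powerful_count_one_le[where ?'a = 'a, of k]
        powerful_bound_le[OF q2, of k] by linarith
    hence "real (powerful_count k h) \<le> real (2 * CARD('a) ^ (k div 2))" by linarith
    also have "\<dots> = 2 * y ^ (2 * (k div 2))" by (simp add: y(2)[symmetric] power_mult)
    also have "\<dots> \<le> 2 * y ^ k" using y(1) by (intro mult_left_mono power_increasing) auto
    finally show ?thesis using True by simp
  next
    case False
    then obtain p where p: "irreducible p" "monic p" "p dvd h"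
      using ex_monic_irreducible_dvd by blast
    obtain g where g: "h = p * g" using p(3) unfolding dvd_def by blast
    have nz: "p \<noteq> 0" "g \<noteq> 0" using less.prems g by auto
    have dp: "degree p > 0" using p nz by (auto simp: irreducible_def is_unit_iff_degree)
    have dh: "degree h = degree p + degree g" using g nz by (simp add: degree_mult_eq)
    have IH: "real (powerful_count k g) \<le> 2 * y ^ k * (1 + 1 / y) ^ degree g" for k
      using less.hyps[of g] dh dp nz by simp
    have one: "1 + (1 / y) ^ degree p \<le> (1 + 1 / y) ^ degree p"
    proof -
      obtain d where d: "degree p = Suc d" using dp gr0_implies_Suc by blast
      have "(1 / y) ^ d \<le> (1 + 1 / y) ^ d" "1 \<le> (1 + 1 / y) ^ d"
        using y(1) by (auto intro!: power_mono one_le_power)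
      hence "1 * 1 + (1 / y) * (1 / y) ^ d \<le> 1 * (1 + 1 / y) ^ d + (1 / y) * (1 + 1 / y) ^ d"
        using y(1) by (intro add_mono mult_left_mono) auto
      thus ?thesis unfolding d by (simp add: algebra_simps)
    qed
    have "real (powerful_count k h)
        \<le> real (powerful_count k g + (if degree p \<le> k then powerful_count (k - degree p) g else 0))"
      using powerful_count_mult_irreducible[OF p(1,2), of k g] g by (simp only: of_nat_le_iff)
    also have "\<dots> \<le> 2 * y ^ k * (1 + 1 / y) ^ degree g + 2 * (y ^ k * (1 / y) ^ degree p) * (1 + 1 / y) ^ degree g"
    proof -
      have "real (if degree p \<le> k then powerful_count (k - degree p) g else 0)
          \<le> 2 * (y ^ k * (1 / y) ^ degree p) * (1 + 1 / y) ^ degree g"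
      proof (cases "degree p \<le> k")
        case True
        have "y ^ k * (1 / y) ^ degree p = y ^ (k - degree p)"
          using True y(1) by (simp add: power_diff power_one_over field_simps)
        thus ?thesis using True IH[of "k - degree p"] by simp
      qed (use y(1) in simp)
      thus ?thesis using IH[of k] by simp
    qed
    also have "\<dots> = 2 * y ^ k * (1 + 1 / y) ^ degree g * (1 + (1 / y) ^ degree p)"
      by (simp add: algebra_simps)
    also have "\<dots> \<le> 2 * y ^ k * (1 + 1 / y) ^ degree g * (1 + 1 / y) ^ degree p"
      using y(1) one by (intro mult_left_mono) auto
    finally show ?thesis by (simp add: dh power_add mult_ac)
  qed
qed

text \<open>A sharper form for linear \<open>h\<close> that keeps \<open>powerful_bound\<close>
  itself; it serves the small dimensions. The irreducible factor taken from \<open>h\<close> has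
  degree one and leaves a unit.\<close>

lemma powerful_count_degree_one_le:
  fixes h :: "'a :: {finite, field} poly"
  assumes "monic h" "degree h = 1"
  shows "powerful_count (Suc k) h \<le> powerful_bound CARD('a) (Suc k) + powerful_bound CARD('a) k"
proof -
  obtain p where p: "irreducible p" "monic p" "p dvd h"
    using ex_monic_irreducible_dvd[of h] assms by auto
  obtain g where g: "h = p * g" using p(3) unfolding dvd_def by blast
  have nz: "p \<noteq> 0" "g \<noteq> 0" using assms g by auto
  have dp: "degree p > 0" using p nz by (auto simp: irreducible_def is_unit_iff_degree)
  have "degree p = 1" "degree g = 0" using assms(2) g nz dp by (auto simp: degree_mult_eq)
  hence u: "g dvd 1" using nz by (simp add: is_unit_iff_degree)
  show ?thesis
    using powerful_count_mult_irreducible[OF p(1,2), of "Suc k" g] \<open>degree p = 1\<close>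
      powerful_count_unit[OF u, of "Suc k"] powerful_count_unit[OF u, of k]
      powerful_count_one_le[where ?'a = 'a, of k] powerful_count_one_le[where ?'a = 'a, of "Suc k"]
    unfolding g by simp
qed

subsection \<open>Numerical estimates\<close>

lemma sum_powers_le:
  fixes q :: real
  assumes "q \<ge> 2" shows "(\<Sum>i<m. q ^ i) \<le> q ^ m"
proof (induction m)
  case (Suc m)
  have "2 * q ^ m \<le> q * q ^ m" using assms by (intro mult_right_mono) auto
  thus ?case using Suc by simp
qed simp

text \<open>Covers the trivially estimated terms in medium dimensions: reversed, they form a
  geometric series below \<open>q ^ (n - 1)\<close>, hence at most half of
  \<open>q ^ n\<close>.\<close>

lemma tail_sum_le:
  fixes q :: real
  assumes q: "q \<ge> 2" and n: "n \<ge> 2"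
  shows "(\<Sum>j=2..<n. q ^ (n - j)) \<le> q ^ n / 2"
proof -
  have "(\<Sum>j=2..<n. q ^ (n - j)) = (\<Sum>i=1..<n-1. q ^ i)"
    by (rule sum.reindex_bij_witness[of _ "\<lambda>i. n - i" "\<lambda>j. n - j"]) auto
  also have "\<dots> \<le> (\<Sum>i<n-1. q ^ i)" using q by (intro sum_mono2) auto
  also have "\<dots> \<le> q ^ (n - 1)" by (rule sum_powers_le[OF q])
  also have "\<dots> \<le> q * q ^ (n - 1) / 2" using q by simp
  also have "q * q ^ (n - 1) = q ^ n" using n by (metis Suc_diff_1 power_Suc zero_less_numeral less_le_trans)
  finally show ?thesis by simp
qed

text \<open>The defining recursion with \<open>k\<close> in place of \<open>k + 3\<close>, which
  flips the parity test; this form evaluates at numerals.\<close>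

lemma powerful_bound_step:
  "k \<ge> 3 \<Longrightarrow> powerful_bound q k = (if even k then q ^ (k div 2) else 0) + q * powerful_bound q (k - 3)"
  by (cases "(q, k)" rule: powerful_bound.cases) (auto simp: numeral_3_eq_3)

lemma powerful_bound_values:
  "powerful_bound q 1 = 0" "powerful_bound q 2 = q" "powerful_bound q 3 = q"
  "powerful_bound q 4 = q ^ 2" "powerful_bound q 5 = q ^ 2" "powerful_bound q 6 = q ^ 3 + q ^ 2"
  "powerful_bound q 7 = q ^ 3"
proof -
  show 1: "powerful_bound q 1 = 0" by simp
  show 2: "powerful_bound q 2 = q" by (simp add: numeral_2_eq_2)
  show 3: "powerful_bound q 3 = q" by (simp add: powerful_bound_step)
  show 4: "powerful_bound q 4 = q ^ 2" using 1 by (simp add: powerful_bound_step)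
  show "powerful_bound q 5 = q ^ 2" using 2 by (simp add: powerful_bound_step power2_eq_square)
  show "powerful_bound q 6 = q ^ 3 + q ^ 2" using 3 by (simp add: powerful_bound_step power2_eq_square)
  show "powerful_bound q 7 = q ^ 3" using 4 by (simp add: powerful_bound_step power2_eq_square power3_eq_cube)
qed

text \<open>With explicit values inserted, each case is a linear inequality between powers
  \<open>q ^ m\<close>. The fact \<open>le\<close> compares each of them with \<open>q ^ n\<close>
  at the rate attained for \<open>q = 2\<close>, the worst case.\<close>

lemma small_dimension_bound:
  assumes q: "q \<ge> 2" and n: "2 \<le> n" "n \<le> 7"
  shows "real (powerful_bound q n + (powerful_bound q (n - 1) + powerful_bound q (n - 2)))
      + (\<Sum>j=2..<n. real q ^ (n - j)) \<le> (983 / 1000) ^ n * real q ^ n"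
proof -
  have le: "real q ^ m * 2 ^ (n - m) \<le> real q ^ n" if "m \<le> n" for m
  proof -
    have "real q ^ m * 2 ^ (n - m) \<le> real q ^ m * real q ^ (n - m)"
      using q by (intro mult_left_mono power_mono) auto
    thus ?thesis using that by (simp add: power_add[symmetric])
  qed
  consider "n = 2" | "n = 3" | "n = 4" | "n = 5" | "n = 6" | "n = 7" using n by linarith
  thus ?thesis
  proof cases
    case 1
    have s: "{2..<2 :: nat} = {}" by auto
    show ?thesis using le[of 0] le[of 1]
      unfolding 1 powerful_bound_values s by (simp add: powerful_bound_values power_divide)
  next
    case 2
    have s: "{2..<3 :: nat} = {2}" by auto
    show ?thesis using le[of 0] le[of 1] le[of 2]
      unfolding 2 powerful_bound_values s by (simp add: powerful_bound_values power_divide)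
  next
    case 3
    have s: "{2..<4 :: nat} = {2, 3}" by auto
    show ?thesis using le[of 0] le[of 1] le[of 2] le[of 3]
      unfolding 3 powerful_bound_values s by (simp add: powerful_bound_values power_divide)
  next
    case 4
    have s: "{2..<5 :: nat} = {2, 3, 4}" by auto
    show ?thesis using le[of 0] le[of 1] le[of 2] le[of 3] le[of 4]
      unfolding 4 powerful_bound_values s by (simp add: powerful_bound_values power_divide)
  next
    case 5
    have s: "{2..<6 :: nat} = {2, 3, 4, 5}" by auto
    show ?thesis using le[of 0] le[of 1] le[of 2] le[of 3] le[of 4] le[of 5]
      unfolding 5 powerful_bound_values s by (simp add: powerful_bound_values power_divide)
  next
    case 6
    have s: "{2..<7 :: nat} = {2, 3, 4, 5, 6}" by auto
    show ?thesis using le[of 0] le[of 1] le[of 2] le[of 3] le[of 4] le[of 5] le[of 6]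
      unfolding 6 powerful_bound_values s by (simp add: powerful_bound_values power_divide)
  qed
qed

text \<open>Here \<open>y ^ 2\<close> stands for the field size. The terms \<open>j = 0, 1\<close>
  are of order \<open>y ^ n\<close>, and the terms \<open>j >= 2\<close> use up at most half of
  \<open>(y ^ 2) ^ n\<close>; it remains to compare \<open>y ^ n\<close> with
  \<open>(y ^ 2) ^ n\<close>.\<close>

lemma medium_dimension_bound:
  fixes y :: real
  assumes y: "y \<ge> 0" "y ^ 2 \<ge> 2" and n: "8 \<le> n" "n \<le> 16"
  shows "2 * y ^ n + 2 * y ^ (n - 1) * (1 + 1 / y) + (\<Sum>j=2..<n. (y ^ 2) ^ (n - j))
      \<le> (983 / 1000) ^ n * (y ^ 2) ^ n"
proof -
  define z where "z = 1 / y"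
  have y0: "y > 0" using y by (cases "y = 0") auto
  have y1: "y \<ge> 1414 / 1000" by (rule power2_le_imp_le) (use y in \<open>auto simp: power2_eq_square\<close>)
  \<comment> \<open>A value just above \<open>1 / sqrt 2\<close>; together with
    \<open>z ^ 2 \<le> 1 / 2\<close> it yields the factor \<open>2208 / 1000\<close> below.\<close>
  hence z: "z \<le> 708 / 1000" "z \<ge> 0" using y0 by (auto simp: z_def field_simps)
  have zz: "z ^ 2 \<le> 1 / 2" using y y0 by (simp add: z_def power_divide field_simps)
  have yn: "y ^ n = y * y ^ (n - 1)" using n by (cases n) auto
  have "2 * y ^ n + 2 * y ^ (n - 1) * (1 + 1 / y) = 2 * y ^ n * (1 + z + z ^ 2)"
    unfolding yn z_def using y0 by (simp add: field_simps power2_eq_square)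
  also have "\<dots> \<le> 2 * y ^ n * (2208 / 1000)" using z zz y by (intro mult_left_mono) auto
  finally have head: "2 * y ^ n + 2 * y ^ (n - 1) * (1 + 1 / y) \<le> 4416 / 1000 * y ^ n" by simp
  have tail: "(\<Sum>j=2..<n. (y ^ 2) ^ (n - j)) \<le> (y ^ 2) ^ n / 2"
    using tail_sum_le[OF y(2)] n by simp
  have sq: "(y ^ 2) ^ n = y ^ n * y ^ n" by (simp add: power_mult[symmetric] power_add[symmetric] mult_2)
  \<comment> \<open>Since \<open>y ^ n \<ge> 2 ^ m\<close>, the first two terms are at most
    \<open>4.416 / 2 ^ m\<close> times \<open>(y ^ 2) ^ n\<close>, which leaves a purely numerical
    condition on \<open>m\<close> and \<open>n\<close>.\<close>
  have main: ?thesis if m: "2 * m \<le> n" and c: "4416 / 1000 / 2 ^ m + 1 / 2 \<le> (983 / 1000 :: real) ^ n" for m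
  proof -
    have "2 ^ m \<le> (y ^ 2) ^ m" using y by (intro power_mono) auto
    also have "\<dots> \<le> y ^ n" unfolding power_mult[symmetric] using y1 m by (intro power_increasing) auto
    finally have "2 ^ m * y ^ n \<le> y ^ n * y ^ n" using y0 by (intro mult_right_mono) auto
    hence "4416 / 1000 * y ^ n \<le> 4416 / 1000 / 2 ^ m * (y ^ 2) ^ n" unfolding sq by (simp add: field_simps)
    hence "2 * y ^ n + 2 * y ^ (n - 1) * (1 + 1 / y) + (\<Sum>j=2..<n. (y ^ 2) ^ (n - j))
        \<le> (4416 / 1000 / 2 ^ m + 1 / 2) * (y ^ 2) ^ n"
      using head tail unfolding distrib_right by linarith
    also have "\<dots> \<le> (983 / 1000) ^ n * (y ^ 2) ^ n" using c by (intro mult_right_mono) auto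
    finally show ?thesis .
  qed
  show ?thesis
  \<comment> \<open>\<open>m = 4\<close> is available from \<open>n = 8\<close> on and suffices up
    to 14, where 0.776 is compared with \<open>0.983 ^ 14\<close>, about 0.787. Beyond that
    \<open>m = 7\<close> is available.\<close>
  proof (cases "n \<le> 14")
    case True
    have "4416 / 1000 / 2 ^ 4 + 1 / 2 \<le> (983 / 1000 :: real) ^ 14" by (simp add: power_divide)
    also have "\<dots> \<le> (983 / 1000) ^ n" using True by (intro power_decreasing) auto
    finally show ?thesis using n by (intro main[of 4]) auto
  next
    case False
    have "4416 / 1000 / 2 ^ 7 + 1 / 2 \<le> (983 / 1000 :: real) ^ 16" by (simp add: power_divide)
    also have "\<dots> \<le> (983 / 1000) ^ n" using n by (intro power_decreasing) auto
    finally show ?thesis using False by (intro main[of 7]) auto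
  qed
qed

text \<open>With \<open>z = 1 / y\<close> each term is \<open>(y ^ 2) ^ n\<close> times
  \<open>2 * z ^ n * (z + z ^ 2) ^ j\<close>. This increases with \<open>z\<close>, so
  \<open>z\<close> may be replaced by an upper bound near \<open>1 / sqrt 2\<close>, and a geometric
  sum remains.\<close>

lemma large_dimension_bound:
  fixes y :: real
  assumes y: "y \<ge> 0" "y ^ 2 \<ge> 2" and n: "n \<ge> 17"
  shows "(\<Sum>j<n. 2 * y ^ (n - j) * (1 + 1 / y) ^ j) \<le> (983 / 1000) ^ n * (y ^ 2) ^ n"
proof -
  define z where "z = 1 / y"
  \<comment> \<open>\<open>z0\<close> is slightly above \<open>1 / sqrt 2\<close>. As
    \<open>r0\<close> exceeds 1.207, the geometric sum is at most \<open>r0 ^ n / 0.207\<close>, and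
    \<open>z0 * r0\<close> is below 0.8539.\<close>
  define z0 r0 :: real where "z0 = 7072 / 10000" and "r0 = z0 + z0 ^ 2"
  have y0: "y > 0" using y by (cases "y = 0") auto
  have z: "z \<le> z0" "z \<ge> 0"
  proof -
    have "z ^ 2 \<le> 1 / 2" using y y0 by (simp add: z_def power_divide field_simps)
    also have "\<dots> \<le> z0 ^ 2" by (simp add: z0_def power2_eq_square)
    finally show "z \<le> z0" by (rule power2_le_imp_le) (simp add: z0_def)
    show "z \<ge> 0" using y0 by (simp add: z_def)
  qed
  have "2 * y ^ (n - j) * (1 + 1 / y) ^ j \<le> (y ^ 2) ^ n * (2 * z0 ^ n * r0 ^ j)" if "j < n" for j
  proof -
    have "y ^ (n - j) = y ^ n * z ^ j" using y0 that by (simp add: z_def power_diff power_one_over field_simps)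
    moreover have "y ^ n = (y ^ 2) ^ n * z ^ n"
      using y0 by (simp add: z_def power_one_over power_mult[symmetric] mult_2 power_add)
    ultimately have "2 * y ^ (n - j) * (1 + 1 / y) ^ j = (y ^ 2) ^ n * (2 * z ^ n * (z + z ^ 2) ^ j)"
    proof -
      assume e: "y ^ (n - j) = y ^ n * z ^ j" "y ^ n = (y ^ 2) ^ n * z ^ n"
      have r: "(z + z ^ 2) ^ j = z ^ j * (1 + z) ^ j"
        by (simp only: power_mult_distrib[symmetric]) (simp add: algebra_simps power2_eq_square)
      have "2 * y ^ (n - j) * (1 + 1 / y) ^ j = 2 * (y ^ n * z ^ j) * (1 + z) ^ j"
        by (simp only: e(1) z_def[symmetric])
      also have "\<dots> = 2 * ((y ^ 2) ^ n * z ^ n * z ^ j) * (1 + z) ^ j" by (simp only: e(2)[symmetric])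
      finally show ?thesis unfolding r by (simp only: mult_ac)
    qed
    also have "\<dots> \<le> (y ^ 2) ^ n * (2 * z0 ^ n * r0 ^ j)"
      unfolding r0_def using z by (intro mult_left_mono mult_mono power_mono add_mono) auto
    finally show ?thesis .
  qed
  hence "(\<Sum>j<n. 2 * y ^ (n - j) * (1 + 1 / y) ^ j) \<le> (\<Sum>j<n. (y ^ 2) ^ n * (2 * z0 ^ n * r0 ^ j))"
    by (intro sum_mono) auto
  also have "\<dots> = (y ^ 2) ^ n * (2 * z0 ^ n * (\<Sum>j<n. r0 ^ j))" by (simp add: sum_distrib_left)
  also have "\<dots> \<le> (y ^ 2) ^ n * (983 / 1000) ^ n"
  proof (intro mult_left_mono)
    have r0: "r0 > 1207 / 1000" "r0 - 1 > 0" by (simp_all add: r0_def z0_def power2_eq_square)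
    have "(\<Sum>j<n. r0 ^ j) = (r0 ^ n - 1) / (r0 - 1)" using r0 by (simp add: geometric_sum)
    also have "\<dots> \<le> r0 ^ n / (r0 - 1)" using r0 by (intro divide_right_mono) auto
    also have "\<dots> \<le> r0 ^ n / (207 / 1000)" using r0 by (intro divide_left_mono) auto
    finally have "2 * z0 ^ n * (\<Sum>j<n. r0 ^ j) \<le> 2 * z0 ^ n * (r0 ^ n / (207 / 1000))"
      by (intro mult_left_mono) (auto simp: z0_def)
    also have "\<dots> = 2000 / 207 * (z0 * r0) ^ n" by (simp add: power_mult_distrib)
    also have "\<dots> \<le> 2000 / 207 * (8539 / 10000) ^ n"
      by (intro mult_left_mono power_mono) (auto simp: z0_def r0_def power2_eq_square)
    \<comment> \<open>17 is the first exponent at which \<open>2000 / 207 * 0.8539 ^ n\<close> drops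
      below \<open>0.983 ^ n\<close>; the other \<open>n - 17\<close> factors are compared one by
      one.\<close>
    also have "\<dots> = (2000 / 207 * (8539 / 10000) ^ 17) * (8539 / 10000) ^ (n - 17)"
      using n by (simp add: power_add[symmetric] del: power_numeral power_divide)
    also have "\<dots> \<le> (983 / 1000) ^ 17 * (983 / 1000) ^ (n - 17)"
    proof (rule mult_mono)
      show "2000 / 207 * (8539 / 10000) ^ 17 \<le> (983 / 1000 :: real) ^ 17" by (simp add: power_divide)
    qed (auto intro!: power_mono)
    also have "\<dots> = (983 / 1000) ^ n" using n by (simp add: power_add[symmetric] del: power_numeral power_divide)
    finally show "2 * z0 ^ n * (\<Sum>j<n. r0 ^ j) \<le> (983 / 1000) ^ n" .
  qed auto
  finally show ?thesis by (simp add: mult.commute)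
qed

subsection \<open>Row vectors as a module over the polynomial ring\<close>

lemma dim_row_mult [simp]: "dim_vec (row_mult v A) = dim_col A"
  by (simp add: row_mult_def)

lemma row_mult_carrier [simp]: "row_mult v A \<in> carrier_vec n \<longleftrightarrow> dim_col A = n"
  using carrier_vecI[of "row_mult v A" n] carrier_vecD[of "row_mult v A" n] by auto

lemma index_row_mult:
  "j < dim_col A \<Longrightarrow> row_mult v A $ j = (\<Sum>i<dim_row A. v $ i * A $$ (i, j))"
  by (simp add: row_mult_def)

lemma row_mult_transpose:
  assumes "A \<in> carrier_mat m n" "v \<in> carrier_vec m"
  shows "row_mult v A = transpose_mat A *\<^sub>v v"
  using assms by (intro eq_vecI)
    (auto simp: index_row_mult scalar_prod_def mult.commute atLeast0LessThan intro!: sum.cong)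

lemma row_mult_mult:
  assumes A: "A \<in> carrier_mat m n" and B: "B \<in> carrier_mat n l" and v: "v \<in> carrier_vec m"
  shows "row_mult v (A * B) = row_mult (row_mult v A) B"
proof -
  have "row_mult v (A * B) = transpose_mat (A * B) *\<^sub>v v"
    using assms by (intro row_mult_transpose) auto
  also have "\<dots> = transpose_mat B *\<^sub>v (transpose_mat A *\<^sub>v v)"
    using assms by (subst transpose_mult[OF A B]) (auto intro!: assoc_mult_mat_vec)
  also have "\<dots> = row_mult (row_mult v A) B"
    using assms by (simp add: row_mult_transpose[OF A v] row_mult_transpose[OF B])
  finally show ?thesis .
qed

lemma row_mult_add_vec:
  assumes "A \<in> carrier_mat m n" "v \<in> carrier_vec m" "w \<in> carrier_vec m"
  shows "row_mult (v + w) A = row_mult v A + row_mult w A"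
  using assms by (intro eq_vecI) (auto simp: index_row_mult sum.distrib[symmetric] algebra_simps intro!: sum.cong)

lemma row_mult_smult_vec:
  assumes "A \<in> carrier_mat m n" "v \<in> carrier_vec m"
  shows "row_mult (c \<cdot>\<^sub>v v) A = c \<cdot>\<^sub>v row_mult v A"
  using assms by (intro eq_vecI) (auto simp: index_row_mult sum_distrib_left mult.assoc intro!: sum.cong)

lemma row_mult_add_mat:
  assumes "A \<in> carrier_mat m n" "B \<in> carrier_mat m n"
  shows "row_mult v (A + B) = row_mult v A + row_mult v B"
  using assms
  by (intro eq_vecI) (auto simp: index_row_mult sum.distrib[symmetric] algebra_simps intro!: sum.cong)

lemma row_mult_smult_one:
  assumes "v \<in> carrier_vec n"
  shows "row_mult v (c \<cdot>\<^sub>m 1\<^sub>m n) = c \<cdot>\<^sub>v v"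
proof (rule eq_vecI)
  fix j assume "j < dim_vec (c \<cdot>\<^sub>v v)"
  hence j: "j < n" using assms by simp
  have "row_mult v (c \<cdot>\<^sub>m 1\<^sub>m n) $ j = (\<Sum>i<n. v $ i * (c \<cdot>\<^sub>m 1\<^sub>m n) $$ (i, j))"
    using j index_row_mult[of j "c \<cdot>\<^sub>m 1\<^sub>m n" v] by simp
  also have "\<dots> = (\<Sum>i<n. if i = j then c * v $ j else 0)"
    using j by (intro sum.cong) auto
  finally have "row_mult v (c \<cdot>\<^sub>m 1\<^sub>m n) $ j = (\<Sum>i<n. if i = j then c * v $ j else 0)" .
  thus "row_mult v (c \<cdot>\<^sub>m 1\<^sub>m n) $ j = (c \<cdot>\<^sub>v v) $ j" using j assms by simp
qed (use assms in simp)

lemma row_mult_one: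
  fixes v :: "'a :: comm_ring_1 vec"
  assumes "v \<in> carrier_vec n" shows "row_mult v (1\<^sub>m n) = v"
proof -
  have "1 \<cdot>\<^sub>m 1\<^sub>m n = (1\<^sub>m n :: 'a mat)" by (intro eq_matI) auto
  thus ?thesis using row_mult_smult_one[OF assms, of 1] by simp
qed

lemma row_mult_zero_vec: "A \<in> carrier_mat m n \<Longrightarrow> row_mult (0\<^sub>v m) A = 0\<^sub>v n"
  by (intro eq_vecI) (auto simp: index_row_mult row_mult_def)

lemma row_mult_zero_mat: "row_mult v (0\<^sub>m m n) = 0\<^sub>v n"
  by (intro eq_vecI) (auto simp: row_mult_def)

lemma row_mult_row:
  assumes "A \<in> carrier_mat m n" "B \<in> carrier_mat n l" "i < m"
  shows "row (A * B) i = row_mult (row A i) B"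
  using assms by (intro eq_vecI) (auto simp: index_row_mult scalar_prod_def atLeast0LessThan row_mult_def intro!: sum.cong)

section \<open>Evaluation of polynomials at a matrix and their action on row vectors\<close>

lemma dim_poly_mat [simp]:
  "dim_row (poly_mat p X) = dim_row X" "dim_col (poly_mat p X) = dim_row X"
proof -
  have "dim_row (horner_mat (dim_row X) X cs) = dim_row X \<and> dim_col (horner_mat (dim_row X) X cs) = dim_row X" for cs
    by (induction cs) auto
  thus "dim_row (poly_mat p X) = dim_row X" "dim_col (poly_mat p X) = dim_row X"
    by (auto simp: poly_mat_def)
qed

lemma poly_mat_carrier: "X \<in> carrier_mat n n \<Longrightarrow> poly_mat p X \<in> carrier_mat n n"
  by auto

lemma poly_mat_pCons:
  fixes X :: "'a :: comm_ring_1 mat"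
  assumes X: "X \<in> carrier_mat n n"
  shows "poly_mat (pCons c p) X = c \<cdot>\<^sub>m 1\<^sub>m n + X * poly_mat p X"
\<comment> \<open>\<open>coeffs (pCons 0 0)\<close> is empty, so only in this case does the
  recursion of \<open>horner_mat\<close> not unfold.\<close>
proof (cases "c = 0 \<and> p = 0")
  case True
  have "X * 0\<^sub>m n n = 0\<^sub>m n n" using X by simp
  moreover have "(0 :: 'a) \<cdot>\<^sub>m 1\<^sub>m n = 0\<^sub>m n n" by (intro eq_matI) auto
  moreover have "dim_row X = n" using X by simp
  ultimately show ?thesis using True by (simp add: poly_mat_def)
next
  case False
  thus ?thesis using X by (auto simp: poly_mat_def cCons_def)
qed

definition poly_act :: "'a :: comm_ring_1 mat \<Rightarrow> 'a poly \<Rightarrow> 'a vec \<Rightarrow> 'a vec" where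
  "poly_act X p v = row_mult v (poly_mat p X)"

context
  fixes X :: "'a :: comm_ring_1 mat" and n :: nat
  assumes X: "X \<in> carrier_mat n n"
begin

lemma dim_poly_act [simp]: "dim_vec (poly_act X p v) = n"
  using X by (auto simp: poly_act_def)

lemma poly_act_carrier [simp]: "poly_act X p v \<in> carrier_vec n"
  by (rule carrier_vecI) simp

lemma poly_act_0: "poly_act X 0 v = 0\<^sub>v n"
  using X by (simp add: poly_act_def poly_mat_def row_mult_zero_mat)

text \<open>A row vector meets the left factor \<open>X\<close> of the Horner form first. Inductions
  on the polynomial therefore pass from \<open>v\<close> to \<open>row_mult v X\<close> and keep
  \<open>v\<close> arbitrary.\<close>

lemma poly_act_pCons:
  assumes "v \<in> carrier_vec n"
  shows "poly_act X (pCons c p) v = c \<cdot>\<^sub>v v + poly_act X p (row_mult v X)"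
  unfolding poly_act_def poly_mat_pCons[OF X]
  using X assms by (subst row_mult_add_mat[of _ n n]) (auto simp: row_mult_smult_one row_mult_mult[OF X poly_mat_carrier[OF X]])

lemma poly_act_zero_vec: "poly_act X p (0\<^sub>v n) = 0\<^sub>v n"
  using X by (auto simp: poly_act_def row_mult_zero_vec[OF poly_mat_carrier[OF X]])

lemma poly_act_add_vec:
  "v \<in> carrier_vec n \<Longrightarrow> w \<in> carrier_vec n \<Longrightarrow> poly_act X p (v + w) = poly_act X p v + poly_act X p w"
  using X by (auto simp: poly_act_def row_mult_add_vec[OF poly_mat_carrier[OF X]])

lemma poly_act_smult_vec:
  "v \<in> carrier_vec n \<Longrightarrow> poly_act X p (c \<cdot>\<^sub>v v) = c \<cdot>\<^sub>v poly_act X p v"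
  using X by (auto simp: poly_act_def row_mult_smult_vec[OF poly_mat_carrier[OF X]])

lemma poly_act_add:
  "v \<in> carrier_vec n \<Longrightarrow> poly_act X (p + q) v = poly_act X p v + poly_act X q v"
proof (induction p q arbitrary: v rule: poly_induct2)
  case (pCons a p b q)
  have c: "row_mult v X \<in> carrier_vec n" using X by auto
  have "poly_act X (pCons a p + pCons b q) v
      = (a + b) \<cdot>\<^sub>v v + (poly_act X p (row_mult v X) + poly_act X q (row_mult v X))"
    using pCons.IH[OF c] pCons.prems by (simp add: poly_act_pCons)
  also have "\<dots> = poly_act X (pCons a p) v + poly_act X (pCons b q) v"
    using pCons.prems poly_act_carrier[of p "row_mult v X"] poly_act_carrier[of q "row_mult v X"]
    by (intro eq_vecI) (auto simp: poly_act_pCons algebra_simps)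
  finally show ?case .
qed (simp add: poly_act_0)

lemma poly_act_smult:
  "v \<in> carrier_vec n \<Longrightarrow> poly_act X (Polynomial.smult c p) v = c \<cdot>\<^sub>v poly_act X p v"
proof (induction p arbitrary: v rule: pCons_induct)
  case (pCons a p)
  have c: "row_mult v X \<in> carrier_vec n" using X by auto
  show ?case
    using pCons.IH[OF c] pCons.prems poly_act_carrier[of p "row_mult v X"]
    by (intro eq_vecI) (auto simp: poly_act_pCons algebra_simps)
qed (auto simp: poly_act_0 intro!: eq_vecI)

lemma poly_act_mult:
  "v \<in> carrier_vec n \<Longrightarrow> poly_act X (p * q) v = poly_act X q (poly_act X p v)"
proof (induction p arbitrary: v rule: pCons_induct)
  case (pCons a p)
  have c: "row_mult v X \<in> carrier_vec n" using X by auto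
  have z: "0 \<cdot>\<^sub>v v = 0\<^sub>v n" using pCons.prems by auto
  have "poly_act X (pCons a p * q) v = a \<cdot>\<^sub>v poly_act X q v + poly_act X q (poly_act X p (row_mult v X))"
    using pCons.prems pCons.IH[OF c] by (simp add: poly_act_add poly_act_smult poly_act_pCons z)
  also have "\<dots> = poly_act X q (poly_act X (pCons a p) v)"
    using pCons.prems by (simp add: poly_act_pCons poly_act_add_vec poly_act_smult_vec)
  finally show ?case .
qed (simp add: poly_act_0 poly_act_zero_vec)

text \<open>A linear map that commutes with the action of \<open>t\<close> is a homomorphism of
  polynomial modules. It will be applied to the projection onto a quotient space.\<close>

lemma poly_act_intertwine:
  assumes Y: "Y \<in> carrier_mat m m"
    and carrier: "\<And>v. v \<in> carrier_vec n \<Longrightarrow> \<phi> v \<in> carrier_vec m"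
    and add: "\<And>v w. v \<in> carrier_vec n \<Longrightarrow> w \<in> carrier_vec n \<Longrightarrow> \<phi> (v + w) = \<phi> v + \<phi> w"
    and smult: "\<And>c v. v \<in> carrier_vec n \<Longrightarrow> \<phi> (c \<cdot>\<^sub>v v) = c \<cdot>\<^sub>v \<phi> v"
    and row_mult: "\<And>v. v \<in> carrier_vec n \<Longrightarrow> \<phi> (row_mult v X) = row_mult (\<phi> v) Y"
    and v: "v \<in> carrier_vec n"
  shows "\<phi> (poly_act X p v) = row_mult (\<phi> v) (poly_mat p Y)"
  using v
proof (induction p arbitrary: v rule: pCons_induct)
  case 0
  have "\<phi> (0 \<cdot>\<^sub>v 0\<^sub>v n) = 0 \<cdot>\<^sub>v \<phi> (0\<^sub>v n)" by (rule smult) simp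
  moreover have "0 \<cdot>\<^sub>v 0\<^sub>v n = (0\<^sub>v n :: 'a vec)" "0 \<cdot>\<^sub>v \<phi> (0\<^sub>v n) = 0\<^sub>v m"
    using carrier[of "0\<^sub>v n"] by (auto intro!: eq_vecI)
  ultimately have "\<phi> (0\<^sub>v n) = 0\<^sub>v m" by simp
  thus ?case using Y by (simp add: poly_act_0 poly_mat_def row_mult_zero_mat)
next
  case (pCons a p)
  have c: "row_mult v X \<in> carrier_vec n" using X by auto
  have "\<phi> (poly_act X (pCons a p) v) = a \<cdot>\<^sub>v \<phi> v + row_mult (row_mult (\<phi> v) Y) (poly_mat p Y)"
    using pCons.prems pCons.IH[OF c] by (simp add: poly_act_pCons add smult row_mult)
  also have "\<dots> = row_mult (\<phi> v) (poly_mat (pCons a p) Y)"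
    unfolding poly_mat_pCons[OF Y] using carrier[OF pCons.prems] Y
    by (subst row_mult_add_mat[of _ m m]) (auto simp: row_mult_smult_one row_mult_mult[OF Y poly_mat_carrier[OF Y]])
  finally show ?case .
qed

end

section \<open>Krylov sequences \<open>w, w X, w X^2, ...\<close>\<close>

definition krylov :: "'a :: comm_ring_1 mat \<Rightarrow> 'a vec \<Rightarrow> nat \<Rightarrow> 'a vec" where
  "krylov X w i = ((\<lambda>v. row_mult v X) ^^ i) w"

lemma krylov_0 [simp]: "krylov X w 0 = w" by (simp add: krylov_def)

lemma krylov_Suc: "krylov X w (Suc i) = row_mult (krylov X w i) X" by (simp add: krylov_def)

lemma krylov_Suc': "krylov X w (Suc i) = krylov X (row_mult w X) i"
  by (induction i) (simp_all add: krylov_Suc)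

lemma krylov_carrier [simp]:
  "X \<in> carrier_mat n n \<Longrightarrow> w \<in> carrier_vec n \<Longrightarrow> krylov X w i \<in> carrier_vec n"
  by (cases i) (auto simp: krylov_Suc)

lemma index_poly_act:
  assumes X: "X \<in> carrier_mat n n" and w: "w \<in> carrier_vec n" and j: "j < n"
    and p: "\<And>i. i \<ge> N \<Longrightarrow> coeff p i = 0"
  shows "poly_act X p w $ j = (\<Sum>i<N. coeff p i * krylov X w i $ j)"
  using w p
proof (induction N arbitrary: p w)
  case 0
  hence "p = 0" by (intro poly_eqI) auto
  thus ?case using j by (simp add: poly_act_0[OF X])
next
  case (Suc N)
  obtain c p' where p': "p = pCons c p'" by (cases p) auto
  have "coeff p' i = 0" if "i \<ge> N" for i using Suc.prems(2)[of "Suc i"] that by (simp add: p')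
  hence "poly_act X p' (row_mult w X) $ j = (\<Sum>i<N. coeff p' i * krylov X (row_mult w X) i $ j)"
    using X by (intro Suc.IH) auto
  thus ?case using j Suc.prems(1) dim_poly_act[OF X] unfolding p'
    by (simp add: poly_act_pCons[OF X] sum.lessThan_Suc_shift krylov_Suc' del: sum.lessThan_Suc)
qed

subsection \<open>Companion matrices and Krylov frames\<close>

text \<open>For row vectors this is the action of \<open>t\<close> in a basis
  \<open>w, w X, ..., w X^(k-1)\<close> where \<open>w X^k\<close> is the combination of these with
  coefficients \<open>a\<close>: all rows but the last shift, and the last row is
  \<open>a\<close>.\<close>

definition companion :: "'a :: comm_ring_1 vec \<Rightarrow> 'a mat" where
  "companion a = mat (dim_vec a) (dim_vec a)
     (\<lambda>(r, c). if Suc r < dim_vec a then (if c = Suc r then 1 else 0) else a $ c)"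

definition companion_poly :: "'a :: comm_ring_1 vec \<Rightarrow> 'a poly" where
  "companion_poly a = monom 1 (dim_vec a) - (\<Sum>i<dim_vec a. monom (a $ i) i)"

lemma companion_carrier [simp]: "companion a \<in> carrier_mat (dim_vec a) (dim_vec a)"
  by (simp add: companion_def)

lemma coeff_companion_poly:
  "coeff (companion_poly a) i = (if i = dim_vec a then 1 else if i < dim_vec a then - (a $ i) else 0)"
  by (auto simp: companion_poly_def coeff_sum)

lemma degree_companion_poly: "degree (companion_poly (a :: 'a :: idom vec)) = dim_vec a"
  by (intro antisym degree_le le_degree) (auto simp: coeff_companion_poly)

lemma companion_poly_in_monics:
  fixes a :: "'a :: field vec"
  assumes "a \<in> carrier_vec k" shows "companion_poly a \<in> monics k"
  using carrier_vecD[OF assms] by (simp add: monics_def degree_companion_poly coeff_companion_poly)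

lemma companion_poly_inj:
  assumes "companion_poly a = companion_poly b" "dim_vec a = dim_vec b"
  shows "a = b"
proof (rule eq_vecI)
  fix i assume "i < dim_vec b"
  thus "a $ i = b $ i"
    using arg_cong[OF assms(1), of "\<lambda>p. coeff p i"] assms(2) by (simp add: coeff_companion_poly)
qed (fact assms(2))

text \<open>Laplace expansion along the first column, whose only nonzero entries are in the first
  and last rows. One minor is the characteristic matrix of a smaller companion matrix; the other is
  lower triangular with \<open>-1\<close> on the diagonal, and its sign cancels that of the
  cofactor.\<close>

lemma char_poly_companion:
  fixes a :: "'a :: field vec"
  shows "char_poly (companion a) = companion_poly a"
proof (induction "dim_vec a" arbitrary: a)
  case 0
  thus ?case by (simp add: char_poly_defs companion_def companion_poly_def det_dim_zero)
next
  case (Suc m)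
  define M where "M = char_poly_matrix (companion a)"
  have M: "M \<in> carrier_mat (Suc m) (Suc m)" unfolding M_def using Suc.hyps(2) by simp
  have idx: "M $$ (r, c) = (if r = c then [:0, 1:] else 0) +
      [:- (if Suc r < Suc m then (if c = Suc r then 1 else 0) else a $ c):]"
    if "r < Suc m" "c < Suc m" for r c
    unfolding M_def char_poly_matrix_def companion_def using that Suc.hyps(2) by simp
  have cp: "char_poly (companion a) = det M" by (simp add: M_def char_poly_def)
  define b where "b = vec m (\<lambda>i. a $ Suc i)"
  have poly: "companion_poly a = pCons (- (a $ 0)) (companion_poly b)"
    using Suc.hyps(2) by (intro poly_eqI) (auto simp: coeff_companion_poly b_def coeff_pCons split: nat.split)
  show ?case
  \<comment> \<open>For \<open>m = 0\<close> the first and last rows coincide.\<close>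
  proof (cases "m = 0")
    case True
    have "det M = M $$ (0, 0)" using M True by (intro det_single) simp
    also have "\<dots> = pCons (- (a $ 0)) (companion_poly b)"
      using True by (simp add: idx b_def companion_poly_def)
    finally show ?thesis using cp poly by simp
  next
    case False
    have zero: "M $$ (i, 0) = 0" if "i < Suc m" "i \<noteq> 0" "i \<noteq> m" for i
      using that by (simp add: idx)
    have "mat_delete M 0 0 = char_poly_matrix (companion b)"
      using M Suc.hyps(2)
      by (intro eq_matI) (auto simp: mat_delete_def idx char_poly_matrix_def companion_def b_def)
    hence c0: "cofactor M 0 0 = companion_poly b"
      using Suc.hyps(1)[of b] by (simp add: cofactor_def char_poly_def b_def)
    define L where "L = mat_delete M m 0"
    have L: "L \<in> carrier_mat m m" unfolding L_def using mat_delete_carrier[OF M] by simp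
    have Lidx: "L $$ (r, c) = (if r = Suc c then [:0, 1:] else 0) + [:- (if c = r then 1 else 0):]"
      if "r < m" "c < m" for r c
      unfolding L_def mat_delete_def using M that by (simp add: idx)
    have "det L = prod_list (diag_mat L)"
      by (rule det_lower_triangular[OF _ L]) (simp add: Lidx)
    also have "diag_mat L = map (\<lambda>i. - 1) [0..<m]"
      unfolding diag_mat_def using L by (auto simp: Lidx one_pCons)
    also have "prod_list \<dots> = (- 1 :: 'a poly) ^ m" by (simp add: map_replicate_const)
    finally have cm: "cofactor M m 0 = 1"
      by (simp add: cofactor_def L_def[symmetric] power_mult_distrib[symmetric])
    have "det M = (\<Sum>i<Suc m. M $$ (i, 0) * cofactor M i 0)"
      by (rule laplace_expansion_column[OF M]) simp
    also have "\<dots> = (\<Sum>i\<in>{0, m}. M $$ (i, 0) * cofactor M i 0)"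
      using zero by (intro sum.mono_neutral_right) auto
    also have "\<dots> = M $$ (0, 0) * companion_poly b + M $$ (m, 0)"
      using False c0 cm by simp
    also have "\<dots> = pCons (- (a $ 0)) (companion_poly b)"
      using False by (simp add: idx)
    finally show ?thesis using cp poly by simp
  qed
qed

lemma char_poly_four_block_upper_right_zero:
  fixes A :: "'a :: field mat"
  assumes A: "A \<in> carrier_mat k k" and B: "B \<in> carrier_mat m k" and D: "D \<in> carrier_mat m m"
  shows "char_poly (four_block_mat A (0\<^sub>m k m) B D) = char_poly A * char_poly D"
proof -
  have "char_poly_matrix (four_block_mat A (0\<^sub>m k m) B D)
      = four_block_mat (char_poly_matrix A) (0\<^sub>m k m) (map_mat (\<lambda>x. [:- x:]) B) (char_poly_matrix D)"
    using assms by (intro eq_matI) (auto simp: char_poly_matrix_def)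
  thus ?thesis unfolding char_poly_def using assms
    by (simp add: det_four_block_mat_upper_right_zero[of _ k _ m])
qed

section \<open>Bases that begin with a given list of vectors\<close>

definition inverse_pair :: "nat \<Rightarrow> 'a :: field mat \<Rightarrow> 'a mat \<Rightarrow> bool" where
  "inverse_pair n P Q \<longleftrightarrow>
     P \<in> carrier_mat n n \<and> Q \<in> carrier_mat n n \<and> P * Q = 1\<^sub>m n \<and> Q * P = 1\<^sub>m n"

lemma inverse_pair_mult:
  assumes "inverse_pair n E E'" "inverse_pair n P Q"
  shows "inverse_pair n (E * P) (Q * E')"
proof -
  have c: "E \<in> carrier_mat n n" "E' \<in> carrier_mat n n" "P \<in> carrier_mat n n" "Q \<in> carrier_mat n n"
    and i: "E * E' = 1\<^sub>m n" "E' * E = 1\<^sub>m n" "P * Q = 1\<^sub>m n" "Q * P = 1\<^sub>m n"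
    using assms by (auto simp: inverse_pair_def)
  have "E * P * (Q * E') = E * (P * Q) * E'" using c by (simp add: assoc_mult_mat[of _ n n _ n _ n])
  moreover have "Q * E' * (E * P) = Q * (E' * E) * P" using c by (simp add: assoc_mult_mat[of _ n n _ n _ n])
  ultimately show ?thesis using c i by (simp add: inverse_pair_def)
qed

lemma inverse_pair_similar:
  assumes "inverse_pair n P Q" "X \<in> carrier_mat n n"
  shows "char_poly (P * X * Q) = char_poly X"
proof -
  have "similar_mat_wit (P * X * Q) X P Q"
    using assms by (intro similar_mat_witI[of _ _ n]) (auto simp: inverse_pair_def)
  thus ?thesis using char_poly_similar similar_mat_def by blast
qed

text \<open>An exchange step: \<open>P\<close> is the identity matrix with row \<open>i\<close>
  replaced by \<open>u\<close> and, if \<open>l\<close> differs from \<open>i\<close>, row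
  \<open>l\<close> replaced by the unit vector lost in row \<open>i\<close>. The condition
  \<open>u $ l \<noteq> 0\<close> makes the kernel trivial.\<close>

lemma ex_inverse_pair_row:
  fixes u :: "'a :: field vec"
  assumes u: "u \<in> carrier_vec n" and l: "i \<le> l" "l < n" "u $ l \<noteq> 0"
  shows "\<exists>P Q. inverse_pair n P Q \<and> (\<forall>r<i. row P r = unit_vec n r) \<and> row P i = u"
proof -
  define P where "P = mat n n (\<lambda>(r, c). if r = i then u $ c
    else if r = l then (if c = i then 1 else 0) else (if c = r then 1 else 0))"
  have P: "P \<in> carrier_mat n n" by (simp add: P_def)
  have "det P \<noteq> 0"
  proof
    assume "det P = 0"
    then obtain v where v: "v \<in> carrier_vec n" "v \<noteq> 0\<^sub>v n" "P *\<^sub>v v = 0\<^sub>v n"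
      using det_0_iff_vec_prod_zero[OF P] by blast
    have eq: "(\<Sum>c<n. P $$ (r, c) * v $ c) = 0" if "r < n" for r
      using arg_cong[OF v(3), of "\<lambda>x. x $ r"] that v(1) P
      by (simp add: scalar_prod_def atLeast0LessThan)
    have other: "v $ c = 0" if c: "c < n" "c \<noteq> l" for c
    proof (cases "c = i")
      case True
      have "(\<Sum>d<n. P $$ (l, d) * v $ d) = (\<Sum>d<n. if d = i then v $ i else 0)"
        using l c True by (intro sum.cong) (auto simp: P_def)
      thus ?thesis using eq[of l] l True c by simp
    next
      case False
      have "(\<Sum>d<n. P $$ (c, d) * v $ d) = (\<Sum>d<n. if d = c then v $ c else 0)"
        using c False by (intro sum.cong) (auto simp: P_def)
      thus ?thesis using eq[of c] c by simp
    qed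
    have "(\<Sum>d<n. P $$ (i, d) * v $ d) = (\<Sum>d<n. if d = l then u $ l * v $ l else 0)"
      using l other by (intro sum.cong) (auto simp: P_def)
    hence "v $ l = 0" using eq[of i] l by simp
    hence "v $ d = 0" if "d < n" for d using other[OF that] by (cases "d = l") auto
    hence "v = 0\<^sub>v n" using v(1) by (intro eq_vecI) auto
    thus False using v(2) by simp
  qed
  then obtain Q where "inverse_pair n P Q"
    using det_non_zero_imp_unit[OF P, of "()"] P by (auto simp: Units_def ring_mat_def inverse_pair_def)
  moreover have "\<forall>r<i. row P r = unit_vec n r" using l by (auto simp: P_def intro!: eq_vecI)
  moreover have "row P i = u" using l u by (auto simp: P_def intro!: eq_vecI)
  ultimately show ?thesis by blast
qed

text \<open>The rows of \<open>P\<close> form a basis beginning with \<open>vs\<close>, and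
  \<open>row_mult v Q\<close> lists the coordinates of \<open>v\<close> in it. Existence of a frame
  thus expresses linear independence of \<open>vs\<close>.\<close>

definition is_frame :: "nat \<Rightarrow> 'a :: field vec list \<Rightarrow> 'a mat \<Rightarrow> 'a mat \<Rightarrow> bool" where
  "is_frame n vs P Q \<longleftrightarrow> inverse_pair n P Q \<and> (\<forall>r<length vs. row P r = vs ! r)"

lemma row_mult_unit_vec:
  assumes "P \<in> carrier_mat n m" "r < n"
  shows "row_mult (unit_vec n r) P = row P r"
proof -
  have "row (1\<^sub>m n * P) r = row_mult (row (1\<^sub>m n) r) P"
    using assms by (intro row_mult_row) auto
  thus ?thesis using assms by simp
qed

lemma row_mult_inverse:
  assumes "inverse_pair n P Q" "v \<in> carrier_vec n"
  shows "row_mult (row_mult v P) Q = v" "row_mult (row_mult v Q) P = v"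
  using assms row_mult_mult[of P n n Q n v] row_mult_mult[of Q n n P n v]
  by (auto simp: inverse_pair_def row_mult_one)

text \<open>A nonzero coordinate beyond the first \<open>length vs\<close> ones makes
  \<open>w\<close> independent of \<open>vs\<close>. The exchange matrix \<open>E\<close> works in
  coordinates, hence multiplies \<open>P\<close> from the left.\<close>

lemma is_frame_extend:
  assumes f: "is_frame n vs P Q" and w: "w \<in> carrier_vec n"
    and l: "length vs \<le> l" "l < n" "row_mult w Q $ l \<noteq> 0"
  shows "\<exists>P Q. is_frame n (vs @ [w]) P Q"
proof -
  have ip: "inverse_pair n P Q" and rows: "\<And>r. r < length vs \<Longrightarrow> row P r = vs ! r"
    and P: "P \<in> carrier_mat n n" and Q: "Q \<in> carrier_mat n n"
    using f by (auto simp: is_frame_def inverse_pair_def)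
  have "row_mult w Q \<in> carrier_vec n" using Q by auto
  then obtain E E' where E: "inverse_pair n E E'" "\<And>r. r < length vs \<Longrightarrow> row E r = unit_vec n r"
      "row E (length vs) = row_mult w Q"
    using ex_inverse_pair_row[OF _ l] by blast
  have Ec: "E \<in> carrier_mat n n" using E(1) by (simp add: inverse_pair_def)
  have "row (E * P) r = (vs @ [w]) ! r" if r: "r < Suc (length vs)" for r
  proof -
    have rE: "row (E * P) r = row_mult (row E r) P" using r l by (intro row_mult_row[OF Ec P]) auto
    show ?thesis
    proof (cases "r = length vs")
      case True
      thus ?thesis using rE E(3) row_mult_inverse(2)[OF ip w] by simp
    next
      case False
      thus ?thesis using rE E(2) rows r l P by (simp add: nth_append row_mult_unit_vec)
    qed
  qed
  hence "is_frame n (vs @ [w]) (E * P) (Q * E')"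
    using inverse_pair_mult[OF E(1) ip] by (simp add: is_frame_def)
  thus ?thesis by blast
qed

definition krylov_list :: "'a :: comm_ring_1 mat \<Rightarrow> 'a vec \<Rightarrow> nat \<Rightarrow> 'a vec list" where
  "krylov_list X w k = map (krylov X w) [0..<k]"

text \<open>For the greatest possible \<open>k\<close>, a nonzero coordinate of \<open>w X^k\<close>
  from index \<open>k\<close> on would allow one more vector. The last property covers every frame
  because the counting argument chooses its frame from the list of vectors alone.\<close>

lemma ex_maximal_krylov_frame:
  fixes X :: "'a :: field mat"
  assumes X: "X \<in> carrier_mat n n" and w: "w \<in> carrier_vec n" "w \<noteq> 0\<^sub>v n"
  obtains k where "1 \<le> k" "k \<le> n" "\<exists>P Q. is_frame n (krylov_list X w k) P Q"
    "\<And>P Q l. is_frame n (krylov_list X w k) P Q \<Longrightarrow> k \<le> l \<Longrightarrow> l < n \<Longrightarrow>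
       row_mult (krylov X w k) Q $ l = 0"
proof -
  let ?A = "\<lambda>k. k \<le> n \<and> (\<exists>P Q. is_frame n (krylov_list X w k) P Q)"
  have ext: "?A (Suc k)" if "is_frame n (krylov_list X w k) P Q" "k \<le> l" "l < n"
      "row_mult (krylov X w k) Q $ l \<noteq> 0" for P Q k l
    using is_frame_extend[OF that(1), of "krylov X w k" l] that X w by (simp add: krylov_list_def)
  have base: "is_frame n (krylov_list X w 0) (1\<^sub>m n) (1\<^sub>m n)"
    by (simp add: is_frame_def inverse_pair_def krylov_list_def)
  obtain l where l: "l < n" "w $ l \<noteq> 0" using w by (metis eq_vecI carrier_vecD index_zero_vec)
  have one: "?A 1" using ext[OF base _ l(1)] l w row_mult_one[OF w(1)] by simp
  define k where "k = (GREATEST k. ?A k)"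
  have k: "?A k" unfolding k_def by (rule GreatestI_nat[of ?A, OF one]) auto
  have greatest: "j \<le> k" if "?A j" for j unfolding k_def by (rule Greatest_le_nat[of ?A, OF that]) auto
  show thesis
  proof (rule that[of k])
    show "1 \<le> k" using greatest[OF one] .
    fix P Q l assume "is_frame n (krylov_list X w k) P Q" "k \<le> l" "l < n"
    thus "row_mult (krylov X w k) Q $ l = 0" using ext[of k P Q l] greatest[of "Suc k"] by auto
  qed (use k in auto)
qed

text \<open>In a basis starting with a maximal independent Krylov sequence, \<open>t\<close> acts by a companion
  block and a block on the quotient space.\<close>

lemma krylov_normal_form:
  fixes X :: "'a :: field mat"
  assumes X: "X \<in> carrier_mat n n" and w: "w \<in> carrier_vec n" and k: "1 \<le> k" "k \<le> n"
    and f: "is_frame n (krylov_list X w k) P Q"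
    and zero: "\<And>l. k \<le> l \<Longrightarrow> l < n \<Longrightarrow> row_mult (krylov X w k) Q $ l = 0"
  obtains a B Y where "a \<in> carrier_vec k" "B \<in> carrier_mat (n - k) k" "Y \<in> carrier_mat (n - k) (n - k)"
    "P * X * Q = four_block_mat (companion a) (0\<^sub>m k (n - k)) B Y"
    "poly_act X (companion_poly a) w = 0\<^sub>v n"
proof -
  have ip: "inverse_pair n P Q" and rows: "\<And>r. r < k \<Longrightarrow> row P r = krylov X w r"
    and P: "P \<in> carrier_mat n n" and Q: "Q \<in> carrier_mat n n" and PQ: "P * Q = 1\<^sub>m n"
    using f by (auto simp: is_frame_def inverse_pair_def krylov_list_def)
  define Z where "Z = P * X * Q"
  define v where "v = row_mult (krylov X w k) Q"
  define a where "a = vec k (\<lambda>i. v $ i)"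
  have Z: "Z \<in> carrier_mat n n" unfolding Z_def using P X Q by simp
  \<comment> \<open>Row \<open>r\<close> of \<open>P * X * Q\<close> consists of the frame
    coordinates of \<open>w X^(r+1)\<close>. For \<open>Suc r < k\<close> this vector is itself a
    row of \<open>P\<close>, so its coordinates form a unit vector.\<close>
  have rowZ: "row Z r = row_mult (krylov X w (Suc r)) Q" if r: "r < k" for r
  proof -
    have "row Z r = row_mult (row (P * X) r) Q"
      unfolding Z_def using P X r k by (intro row_mult_row[OF _ Q, of _ n]) auto
    also have "row (P * X) r = row_mult (row P r) X" using r k by (intro row_mult_row[OF P X]) auto
    finally show ?thesis using rows[OF r] by (simp add: krylov_Suc)
  qed
  have Z1: "Z $$ (r, c) = (if Suc r < k then (if c = Suc r then 1 else 0) else v $ c)"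
    if r: "r < k" and c: "c < n" for r c
  proof -
    have "Z $$ (r, c) = row_mult (krylov X w (Suc r)) Q $ c"
      using rowZ[OF r] r c k Z by (metis carrier_matD index_row(1) less_le_trans)
    moreover have "row_mult (krylov X w (Suc r)) Q = unit_vec n (Suc r)" if "Suc r < k"
    proof -
      have "row_mult (krylov X w (Suc r)) Q = row (P * Q) (Suc r)"
        using rows[OF that] that k by (subst row_mult_row[OF P Q]) auto
      thus ?thesis using that k by (simp add: PQ)
    qed
    moreover have "Suc r = k" if "\<not> Suc r < k" using that r by simp
    moreover have "Suc r < n" if "Suc r < k" using that k by simp
    ultimately show ?thesis using c by (auto simp: v_def)
  qed
  define B where "B = mat (n - k) k (\<lambda>(r, c). Z $$ (r + k, c))"
  define Y where "Y = mat (n - k) (n - k) (\<lambda>(r, c). Z $$ (r + k, c + k))"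
  have "Z = four_block_mat (companion a) (0\<^sub>m k (n - k)) B Y"
    using k Z by (intro eq_matI)
      (auto simp: Z1 zero v_def[symmetric] a_def companion_def B_def Y_def zero[folded v_def])
  \<comment> \<open>The coordinates of \<open>w X^k\<close> vanish from index \<open>k\<close> on,
    so \<open>a\<close> expresses it through the earlier Krylov vectors.\<close>
  moreover have "poly_act X (companion_poly a) w = 0\<^sub>v n"
  proof (rule eq_vecI)
    fix j assume "j < dim_vec (0\<^sub>v n :: 'a vec)"
    hence j: "j < n" by simp
    have "krylov X w k $ j = row_mult v P $ j"
      using row_mult_inverse(2)[OF ip krylov_carrier[OF X w]] by (simp add: v_def)
    also have "\<dots> = (\<Sum>i<n. v $ i * P $$ (i, j))" using P j by (simp add: index_row_mult)
    also have "\<dots> = (\<Sum>i<k. v $ i * P $$ (i, j))"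
      using k zero by (intro sum.mono_neutral_right) (auto simp: v_def)
    also have "\<dots> = (\<Sum>i<k. a $ i * krylov X w i $ j)"
    proof (rule sum.cong[OF refl])
      fix i assume "i \<in> {..<k}"
      thus "v $ i * P $$ (i, j) = a $ i * krylov X w i $ j"
        using rows[of i] j k P by (simp add: a_def flip: rows)
    qed
    finally have e: "krylov X w k $ j = (\<Sum>i<k. a $ i * krylov X w i $ j)" .
    have "poly_act X (companion_poly a) w $ j
        = (\<Sum>i<Suc k. coeff (companion_poly a) i * krylov X w i $ j)"
      by (rule index_poly_act[OF X w j]) (simp add: coeff_companion_poly a_def)
    also have "\<dots> = 0" using e by (simp add: coeff_companion_poly a_def sum_negf)
    finally show "poly_act X (companion_poly a) w $ j = 0\<^sub>v n $ j" using j by simp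
  qed (use X in \<open>simp add: dim_poly_act[OF X]\<close>)
  ultimately show thesis
    by (intro that[of a B Y]) (auto simp: Z_def a_def B_def Y_def)
qed

section \<open>Minimal polynomials of vectors and cyclicity of primary components\<close>

lemma poly_act_eq_row_mult_frame:
  fixes X :: "'a :: field mat"
  assumes X: "X \<in> carrier_mat n n" and w: "w \<in> carrier_vec n" and k: "k \<le> n"
    and f: "is_frame n (krylov_list X w k) P Q" and p: "\<And>i. i \<ge> k \<Longrightarrow> coeff p i = 0"
  shows "poly_act X p w = row_mult (vec n (coeff p)) P"
proof (rule eq_vecI)
  have rows: "\<And>r. r < k \<Longrightarrow> row P r = krylov X w r" and P: "P \<in> carrier_mat n n"
    using f by (auto simp: is_frame_def inverse_pair_def krylov_list_def)
  fix j assume "j < dim_vec (row_mult (vec n (coeff p)) P)"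
  hence j: "j < n" using P by simp
  have "poly_act X p w $ j = (\<Sum>i<k. coeff p i * krylov X w i $ j)"
    by (rule index_poly_act[OF X w j p])
  also have "\<dots> = (\<Sum>i<k. vec n (coeff p) $ i * P $$ (i, j))"
    using k j P by (intro sum.cong) (auto simp flip: rows)
  also have "\<dots> = (\<Sum>i<n. vec n (coeff p) $ i * P $$ (i, j))"
    using k p by (intro sum.mono_neutral_left) auto
  finally show "poly_act X p w $ j = row_mult (vec n (coeff p)) P $ j"
    using P j by (simp add: index_row_mult)
qed (use f in \<open>auto simp: dim_poly_act[OF X] is_frame_def inverse_pair_def\<close>)

text \<open>This makes \<open>companion_poly a\<close> the minimal polynomial of \<open>w\<close>:
  the coefficients of the remainder of \<open>p\<close> sit below index \<open>k\<close> and are the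
  frame coordinates of the zero vector.\<close>

lemma companion_poly_dvd_annihilator:
  fixes X :: "'a :: field mat"
  assumes X: "X \<in> carrier_mat n n" and w: "w \<in> carrier_vec n" and k: "k \<le> n"
    and f: "is_frame n (krylov_list X w k) P Q" and a: "a \<in> carrier_vec k"
    and z: "poly_act X (companion_poly a) w = 0\<^sub>v n" and p: "poly_act X p w = 0\<^sub>v n"
  shows "companion_poly a dvd p"
proof -
  let ?f = "companion_poly a"
  have f0: "?f \<noteq> 0" using companion_poly_in_monics[OF a] by (auto simp: monics_def)
  have dk: "degree ?f = k" using a by (simp add: degree_companion_poly)
  define r where "r = p mod ?f"
  have rz: "coeff r i = 0" if "i \<ge> k" for i
    using degree_mod_less[OF f0, of p] that dk coeff_eq_0[of r i] by (auto simp: r_def)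
  have "poly_act X p w = poly_act X (?f * (p div ?f) + r) w" by (simp add: r_def)
  also have "\<dots> = poly_act X (p div ?f) (0\<^sub>v n) + poly_act X r w"
    by (simp only: poly_act_add[OF X w] poly_act_mult[OF X w] z)
  also have "\<dots> = poly_act X r w"
    using poly_act_carrier[OF X, of r w] by (simp add: poly_act_zero_vec[OF X])
  finally have "row_mult (vec n (coeff r)) P = 0\<^sub>v n"
    using p poly_act_eq_row_mult_frame[OF X w k f rz] by simp
  moreover have ip: "inverse_pair n P Q" using f by (simp add: is_frame_def)
  ultimately have "vec n (coeff r) = row_mult (0\<^sub>v n) Q"
    using row_mult_inverse(1)[OF ip, of "vec n (coeff r)"] by simp
  hence e: "vec n (coeff r) = 0\<^sub>v n" using ip by (simp add: inverse_pair_def row_mult_zero_vec[of Q n n])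
  have "coeff r i = 0" for i
  proof (cases "i < k")
    case True
    thus ?thesis using arg_cong[OF e, of "\<lambda>v. v $ i"] k by simp
  qed (use rz in simp)
  hence "r = 0" by (intro poly_eqI) simp
  thus ?thesis by (simp add: r_def mod_eq_0_iff_dvd)
qed

text \<open>An irreducible factor of \<open>f\<close> divides \<open>g ^ m\<close>, hence
  \<open>g\<close>, and is therefore an associate of \<open>g\<close>.\<close>

lemma irreducible_dvd_monic_dvd_power:
  fixes f g :: "'a :: field poly"
  assumes g: "irreducible g" and f: "degree f > 0" "f dvd g ^ m"
  shows "g dvd f"
proof -
  obtain p where p: "irreducible p" "p dvd f" using ex_monic_irreducible_dvd[OF f(1)] by blast
  have "p dvd g ^ m" using p(2) f(2) by (rule dvd_trans)
  hence "p dvd g" using prime_elem_dvd_power[OF field_poly_irreducible_imp_prime[OF p(1)]] by blast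
  hence "g dvd p" by (rule irreducible_dvd_irreducible[OF g p(1)])
  thus ?thesis using p(2) by (rule dvd_trans)
qed

text \<open>Since \<open>k \<ge> 1\<close>, the minimal polynomial of \<open>w\<close> is a
  nonconstant divisor of \<open>g ^ m\<close>, and so \<open>g\<close> divides it.\<close>

lemma krylov_decomposition:
  fixes X :: "'a :: field mat"
  assumes X: "X \<in> carrier_mat n n" and w: "w \<in> carrier_vec n" "w \<noteq> 0\<^sub>v n"
    and g: "irreducible g" and z: "poly_act X (g ^ m) w = 0\<^sub>v n"
  obtains k a B Y P Q where "1 \<le> k" "k \<le> n" "is_frame n (krylov_list X w k) P Q"
    "Y \<in> carrier_mat (n - k) (n - k)" "B \<in> carrier_mat (n - k) k" "a \<in> carrier_vec k"
    "P * X * Q = four_block_mat (companion a) (0\<^sub>m k (n - k)) B Y"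
    "char_poly X = companion_poly a * char_poly Y" "g dvd companion_poly a"
proof -
  obtain k where k: "1 \<le> k" "k \<le> n" and "\<exists>P Q. is_frame n (krylov_list X w k) P Q"
    and zero: "\<And>P Q l. is_frame n (krylov_list X w k) P Q \<Longrightarrow> k \<le> l \<Longrightarrow> l < n \<Longrightarrow>
       row_mult (krylov X w k) Q $ l = 0"
    using ex_maximal_krylov_frame[OF X w] by metis
  then obtain P Q where f: "is_frame n (krylov_list X w k) P Q" by blast
  obtain a B Y where a: "a \<in> carrier_vec k" and B: "B \<in> carrier_mat (n - k) k"
    and Y: "Y \<in> carrier_mat (n - k) (n - k)"
    and Z: "P * X * Q = four_block_mat (companion a) (0\<^sub>m k (n - k)) B Y"
    and az: "poly_act X (companion_poly a) w = 0\<^sub>v n"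
    using krylov_normal_form[OF X w(1) k f zero[OF f]] by metis
  have "companion a \<in> carrier_mat k k" using companion_carrier[of a] carrier_vecD[OF a] by simp
  hence "char_poly X = companion_poly a * char_poly Y"
    using char_poly_four_block_upper_right_zero[OF _ B Y, of "companion a"] f X
      inverse_pair_similar[of n P Q X] Z by (simp add: char_poly_companion is_frame_def)
  moreover have "companion_poly a dvd g ^ m"
    by (rule companion_poly_dvd_annihilator[OF X w(1) k(2) f a az z])
  hence "g dvd companion_poly a"
    using irreducible_dvd_monic_dvd_power[OF g] a k(1) by (simp add: degree_companion_poly)
  ultimately show thesis using that k f a B Y Z by blast
qed

lemma irreducible_dvd_char_poly:
  fixes X :: "'a :: field mat"
  assumes "X \<in> carrier_mat n n" "w \<in> carrier_vec n" "w \<noteq> 0\<^sub>v n"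
    and "irreducible g" "poly_act X (g ^ m) w = 0\<^sub>v n"
  shows "g dvd char_poly X"
  using krylov_decomposition[OF assms] by (metis dvd_mult2)

text \<open>Any nonzero \<open>w\<close> in \<open>V(g)\<close> generates it. The minimal polynomial
  of \<open>w\<close> already contains \<open>g\<close>, so \<open>g\<close> does not divide
  \<open>char_poly Y\<close>. Hence the quotient by the Krylov span of \<open>w\<close> has no
  nonzero vector killed by a power of \<open>g\<close>, and \<open>V(g)\<close> lies in that
  span.\<close>

lemma simple_factor_imp_cyclic:
  fixes X :: "'a :: field mat"
  assumes X: "X \<in> carrier_mat n n" and g: "irreducible g" and sq: "\<not> g ^ 2 dvd char_poly X"
  shows "cyclic_submodule X (primary_component X g)"
proof -
  let ?W = "primary_component X g"
  have W: "?W = {v \<in> carrier_vec n. poly_act X (g ^ n) v = 0\<^sub>v n}"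
    using X by (simp add: primary_component_def poly_act_def)
  have closed: "poly_act X p v \<in> ?W" if "v \<in> ?W" for v p
  proof -
    have v: "v \<in> carrier_vec n" "poly_act X (g ^ n) v = 0\<^sub>v n" using that W by auto
    have "poly_act X (g ^ n) (poly_act X p v) = poly_act X (g ^ n * p) v"
      by (simp only: mult.commute[of "g ^ n"] poly_act_mult[OF X v(1)])
    also have "\<dots> = 0\<^sub>v n" by (simp only: poly_act_mult[OF X v(1)] v(2) poly_act_zero_vec[OF X])
    finally show ?thesis using W poly_act_carrier[OF X] by simp
  qed
  have "\<exists>w\<in>?W. \<forall>v\<in>?W. \<exists>p. v = poly_act X p w"
  proof (cases "\<exists>w\<in>?W. w \<noteq> 0\<^sub>v n")
    \<comment> \<open>If \<open>V(g)\<close> is zero, the zero vector generates it.\<close>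
    case False
    have "0\<^sub>v n \<in> ?W" using W poly_act_zero_vec[OF X] by simp
    thus ?thesis using False poly_act_0[OF X] by metis
  next
    case True
    then obtain w where wW: "w \<in> ?W" and w: "w \<in> carrier_vec n" "w \<noteq> 0\<^sub>v n"
      and wz: "poly_act X (g ^ n) w = 0\<^sub>v n" using W by auto
    obtain k a B Y P Q where k: "1 \<le> k" "k \<le> n" and f: "is_frame n (krylov_list X w k) P Q"
      and Y: "Y \<in> carrier_mat (n - k) (n - k)" and B: "B \<in> carrier_mat (n - k) k"
      and a: "a \<in> carrier_vec k"
      and Z: "P * X * Q = four_block_mat (companion a) (0\<^sub>m k (n - k)) B Y"
      and cp: "char_poly X = companion_poly a * char_poly Y" and ga: "g dvd companion_poly a"
      using krylov_decomposition[OF X w g wz] by metis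
    have ip: "inverse_pair n P Q" and P: "P \<in> carrier_mat n n" and Q: "Q \<in> carrier_mat n n"
      and QP: "Q * P = 1\<^sub>m n" using f by (auto simp: is_frame_def inverse_pair_def)
    let ?Z = "four_block_mat (companion a) (0\<^sub>m k (n - k)) B Y"
    \<comment> \<open>The projection onto the quotient by the Krylov span of \<open>w\<close>, given
      by the last \<open>n - k\<close> frame coordinates.\<close>
    define \<phi> where "\<phi> v = vec (n - k) (\<lambda>i. row_mult v Q $ (i + k))" for v
    have Zc: "?Z \<in> carrier_mat n n" using Z P X Q by (metis mult_carrier_mat)
    have \<phi>row: "\<phi> (row_mult v X) = row_mult (\<phi> v) Y" if v: "v \<in> carrier_vec n" for v
    proof (rule eq_vecI)
      fix i assume "i < dim_vec (row_mult (\<phi> v) Y)"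
      hence i: "i < n - k" using Y by simp
      let ?u = "row_mult v Q"
      have u: "?u \<in> carrier_vec n" using Q by simp
      have "row_mult (row_mult v X) Q = row_mult (row_mult (row_mult ?u P) X) Q"
        using row_mult_inverse(2)[OF ip v] by simp
      also have "\<dots> = row_mult ?u ?Z"
        unfolding Z[symmetric] row_mult_mult[OF mult_carrier_mat[OF P X] Q u] row_mult_mult[OF P X u] ..
      finally have "\<phi> (row_mult v X) $ i = row_mult ?u ?Z $ (i + k)" using i by (simp add: \<phi>_def)
      also have "\<dots> = (\<Sum>r<n. ?u $ r * ?Z $$ (r, i + k))"
        using Zc i by (subst index_row_mult) auto
      \<comment> \<open>The upper right block is zero, so the first \<open>k\<close> coordinates do
        not reach column \<open>i + k\<close>; this is why \<open>\<phi>\<close> commutes with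
        \<open>t\<close>.\<close>
      also have "\<dots> = (\<Sum>r\<in>{k..<n}. ?u $ r * ?Z $$ (r, i + k))"
        using a i Y k by (intro sum.mono_neutral_right) (auto simp: companion_def)
      also have "\<dots> = (\<Sum>r<n - k. ?u $ (r + k) * Y $$ (r, i))"
        using a i Y k
        by (intro sum.reindex_bij_witness[of _ "\<lambda>r. r + k" "\<lambda>r. r - k"]) (auto simp: companion_def)
      also have "\<dots> = row_mult (\<phi> v) Y $ i"
        using i Y by (simp add: index_row_mult \<phi>_def)
      finally show "\<phi> (row_mult v X) $ i = row_mult (\<phi> v) Y $ i" .
    qed (use Y in \<open>simp add: \<phi>_def\<close>)
    have "\<exists>p. v = poly_act X p w" if v: "v \<in> ?W" for v
    proof -
      have vc: "v \<in> carrier_vec n" and vz: "poly_act X (g ^ n) v = 0\<^sub>v n" using v W by auto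
      have "\<phi> (poly_act X (g ^ n) v) = row_mult (\<phi> v) (poly_mat (g ^ n) Y)"
      proof (rule poly_act_intertwine[OF X Y])
        fix x y :: "'a vec" and c assume x: "x \<in> carrier_vec n" and y: "y \<in> carrier_vec n"
        show "\<phi> (x + y) = \<phi> x + \<phi> y"
          using Q k by (intro eq_vecI) (auto simp: \<phi>_def row_mult_add_vec[OF Q x y])
      next
        fix x :: "'a vec" and c assume x: "x \<in> carrier_vec n"
        show "\<phi> (c \<cdot>\<^sub>v x) = c \<cdot>\<^sub>v \<phi> x"
          using Q k by (intro eq_vecI) (auto simp: \<phi>_def row_mult_smult_vec[OF Q x])
      qed (use vc \<phi>row in \<open>auto simp: \<phi>_def\<close>)
      moreover have "\<phi> (0\<^sub>v n) = 0\<^sub>v (n - k)"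
        using k by (intro eq_vecI) (auto simp: \<phi>_def row_mult_zero_vec[OF Q])
      ultimately have Yz: "poly_act Y (g ^ n) (\<phi> v) = 0\<^sub>v (n - k)" using vz by (simp add: poly_act_def)
      have \<phi>v: "\<phi> v = 0\<^sub>v (n - k)"
      proof (rule ccontr)
        assume "\<phi> v \<noteq> 0\<^sub>v (n - k)"
        hence "g dvd char_poly Y"
          by (intro irreducible_dvd_char_poly[OF Y _ _ g Yz]) (auto simp: \<phi>_def)
        hence "g ^ 2 dvd char_poly X" unfolding cp power2_eq_square using ga by (rule mult_dvd_mono[rotated])
        thus False using sq by contradiction
      qed
      let ?u = "row_mult v Q"
      have uz: "?u $ i = 0" if "k \<le> i" "i < n" for i
      proof -
        define j where "j = i - k"
        have j: "i = j + k" using that(1) unfolding j_def by linarith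
        have "j < n - k" using that(2) j by linarith
        moreover from this have "\<phi> v $ j = ?u $ (j + k)" by (simp only: \<phi>_def index_vec)
        ultimately show ?thesis by (simp only: j \<phi>v index_zero_vec)
      qed
      \<comment> \<open>The coordinates of \<open>v\<close> vanish from index \<open>k\<close> on,
        so they serve as coefficients of a polynomial that takes \<open>w\<close> to
        \<open>v\<close>.\<close>
      define p where "p = (\<Sum>i<k. monom (?u $ i) i)"
      have cf: "coeff p i = (if i < k then ?u $ i else 0)" for i by (simp add: p_def coeff_sum)
      have "poly_act X p w = row_mult (vec n (coeff p)) P"
        by (rule poly_act_eq_row_mult_frame[OF X w(1) k(2) f]) (simp add: cf)
      also have "vec n (coeff p) = ?u" using Q uz by (intro eq_vecI) (auto simp: cf)
      finally show ?thesis using row_mult_inverse(2)[OF ip vc] by metis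
    qed
    thus ?thesis using wW by blast
  qed
  then obtain w where w: "w \<in> ?W" "\<forall>v\<in>?W. \<exists>p. v = poly_act X p w" by blast
  have "?W = {poly_act X p w | p. True}" using w closed by blast
  thus ?thesis using w(1) unfolding cyclic_submodule_def poly_act_def by blast
qed

lemma not_f_cyclic_imp_powerful:
  fixes X :: "'a :: field mat"
  assumes X: "X \<in> carrier_mat n n" and n: "\<not> f_cyclic X"
  shows "powerful_off 1 (char_poly X)"
  unfolding powerful_off_def
proof (intro allI impI)
  fix p :: "'a poly" assume p: "irreducible p" "p dvd char_poly X"
  \<comment> \<open>\<open>f_cyclic\<close> speaks of monic divisors, so \<open>p\<close> is scaled
    first.\<close>
  define c where "c = inverse (lead_coeff p)"
  have c: "c \<noteq> 0" using p by (auto simp: c_def irreducible_def)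
  let ?g = "Polynomial.smult c p"
  have "monic ?g" using p by (auto simp: c_def irreducible_def)
  moreover have "irreducible ([:c:] * p)" using p(1) c by (subst irreducible_mult_unit_left) (auto simp: is_unit_iff_degree)
  hence "irreducible ?g" by simp
  moreover have "?g dvd char_poly X" using p(2) c by (simp add: smult_dvd_iff)
  ultimately have "?g ^ 2 dvd char_poly X"
    using n simple_factor_imp_cyclic[OF X, of ?g] unfolding f_cyclic_def by blast
  thus "p ^ 2 dvd char_poly X \<or> p dvd 1" using c by (simp add: smult_power smult_dvd_iff)
qed

subsection \<open>Counting\<close>

lemma bij_betw_carrier_vec:
  "bij_betw (\<lambda>v. restrict (vec_index v) {..<n}) (carrier_vec n) ({..<n} \<rightarrow>\<^sub>E (UNIV :: 'a set))"
  by (rule bij_betwI[where g = "vec n"]) (auto simp: fun_eq_iff PiE_def extensional_def restrict_def)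

lemma bij_betw_carrier_mat:
  "bij_betw (\<lambda>A. restrict (index_mat A) ({..<m} \<times> {..<n})) (carrier_mat m n)
     ({..<m} \<times> {..<n} \<rightarrow>\<^sub>E (UNIV :: 'a set))"
  by (rule bij_betwI[where g = "mat m n"])
    (auto simp: fun_eq_iff PiE_def extensional_def restrict_def intro!: eq_matI)

lemma card_carrier_vec: "card (carrier_vec n :: 'a :: finite vec set) = CARD('a) ^ n"
  using bij_betw_same_card[OF bij_betw_carrier_vec[of n, where ?'a = 'a]] by (simp add: card_PiE)

lemma finite_carrier_vec: "finite (carrier_vec n :: 'a :: finite vec set)"
  using bij_betw_finite[OF bij_betw_carrier_vec[of n, where ?'a = 'a]] by (simp add: finite_PiE)

lemma card_carrier_mat: "card (carrier_mat m n :: 'a :: finite mat set) = CARD('a) ^ (m * n)"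
  using bij_betw_same_card[OF bij_betw_carrier_mat[of m n, where ?'a = 'a]] by (simp add: card_PiE)

lemma finite_carrier_mat: "finite (carrier_mat m n :: 'a :: finite mat set)"
  using bij_betw_finite[OF bij_betw_carrier_mat[of m n, where ?'a = 'a]] by (simp add: finite_PiE)

text \<open>If \<open>p\<close> does not divide \<open>h\<close>, its square must divide
  \<open>f\<close>. This turns the condition on \<open>char_poly X\<close> into one on
  \<open>companion_poly a\<close> for given \<open>Y\<close>.\<close>

lemma powerful_off_factor:
  fixes f h :: "'a :: field poly"
  assumes "powerful_off 1 (f * h)"
  shows "powerful_off h f"
  unfolding powerful_off_def
proof (intro allI impI)
  fix p assume p: "irreducible p" "p dvd f"
  have "p dvd f * h" using p(2) by simp
  hence "p ^ 2 dvd h * f"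
    using powerful_offD[OF assms p(1)] p(1) by (auto simp: irreducible_def mult.commute)
  thus "p ^ 2 dvd f \<or> p dvd h"
    using prime_elem_square_dvd_multD[OF field_poly_irreducible_imp_prime[OF p(1)], of h f] by metis
qed

lemma card_companion_le:
  "card {a \<in> carrier_vec k. powerful_off h (companion_poly (a :: 'a :: {finite, field} vec))}
     \<le> powerful_count k h"
  unfolding powerful_count_def
proof (rule card_inj_on_le[where f = companion_poly])
  show "inj_on companion_poly {a \<in> carrier_vec k. powerful_off h (companion_poly a)}"
    by (rule inj_onI, rule companion_poly_inj) auto
  show "companion_poly ` {a \<in> carrier_vec k. powerful_off h (companion_poly a)}
      \<subseteq> {f \<in> monics k. powerful_off h f}"
    using companion_poly_in_monics by auto
qed (simp add: finite_monics)

text \<open>A bad matrix is recovered from \<open>k\<close>, the later Krylov vectors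
  \<open>vs\<close> of the first unit vector, and the blocks \<open>Y\<close>, \<open>a\<close>,
  \<open>B\<close>. Powerfulness restricts the choice of \<open>a\<close>, and
  \<open>b (n - k)\<close> bounds the number of choices for given \<open>Y\<close>.\<close>

lemma card_not_f_cyclic_le:
  fixes b :: "nat \<Rightarrow> real"
  assumes n: "n \<ge> 1"
    and b: "\<And>j h. j < n \<Longrightarrow> h \<in> monics j \<Longrightarrow>
      real (powerful_count (n - j) (h :: 'a :: {finite, field} poly)) \<le> b j"
  shows "real (card {X \<in> carrier_mat n n. \<not> f_cyclic (X :: 'a mat)})
    \<le> real CARD('a) ^ (n * n - n) * (\<Sum>j<n. b j)"
proof -
  let ?q = "CARD('a)"
  define w :: "'a vec" where "w = unit_vec n 0"
  have w: "w \<in> carrier_vec n" "w \<noteq> 0\<^sub>v n" using n by (auto simp: w_def)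
  \<comment> \<open>The frame is a function of the list alone, so \<open>G\<close> can rebuild a
    matrix without knowing it in advance.\<close>
  define F :: "'a vec list \<Rightarrow> 'a mat \<times> 'a mat"
    where "F vs = (SOME PQ. is_frame n vs (fst PQ) (snd PQ))" for vs
  define FP FQ where "FP vs = fst (F vs)" and "FQ vs = snd (F vs)" for vs
  have frame: "is_frame n vs (FP vs) (FQ vs)" if "\<exists>P Q. is_frame n vs P Q" for vs
    unfolding FP_def FQ_def F_def using that by (intro someI_ex[of "\<lambda>PQ. is_frame n vs (fst PQ) (snd PQ)"]) auto
  \<comment> \<open>The length is \<open>k - 1\<close> because the first Krylov vector is always
    \<open>w\<close>. Dependent lists are included, which only enlarges the bound.\<close>
  define L where "L k = {vs :: 'a vec list. set vs \<subseteq> carrier_vec n \<and> length vs = k - 1}" for k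
  define A where "A k Y = {a \<in> carrier_vec k. powerful_off (char_poly Y) (companion_poly (a :: 'a vec))}" for k Y
  define D where "D k = L k \<times> (SIGMA Y : carrier_mat (n - k) (n - k). A k Y \<times> (carrier_mat (n - k) k :: 'a mat set))" for k
  define G where "G k = (\<lambda>(vs, Y, a, B).
    FQ (w # vs) * four_block_mat (companion a) (0\<^sub>m k (n - k)) B Y * FP (w # vs))" for k
  have finL: "finite (L k)" for k unfolding L_def by (rule finite_lists_length_eq[OF finite_carrier_vec])
  have finA: "finite (A k Y)" for k Y unfolding A_def by (simp add: finite_carrier_vec)
  have finD: "finite (D k)" for k
    unfolding D_def by (intro finite_cartesian_product finite_SigmaI finL finA finite_carrier_mat)
  have sub: "{X \<in> carrier_mat n n. \<not> f_cyclic (X :: 'a mat)} \<subseteq> (\<Union>k\<in>{1..n}. G k ` D k)"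
  proof
    fix X :: "'a mat" assume "X \<in> {X \<in> carrier_mat n n. \<not> f_cyclic X}"
    hence X: "X \<in> carrier_mat n n" and pw: "powerful_off 1 (char_poly X)"
      using not_f_cyclic_imp_powerful by auto
    obtain k where k: "1 \<le> k" "k \<le> n" and ex: "\<exists>P Q. is_frame n (krylov_list X w k) P Q"
      and zero: "\<And>P Q l. is_frame n (krylov_list X w k) P Q \<Longrightarrow> k \<le> l \<Longrightarrow> l < n \<Longrightarrow>
         row_mult (krylov X w k) Q $ l = 0"
      using ex_maximal_krylov_frame[OF X w] by metis
    define vs where "vs = map (krylov X w) [1..<k]"
    have kl: "krylov_list X w k = w # vs"
      using k by (simp add: krylov_list_def vs_def upt_conv_Cons)
    define P Q where "P = FP (w # vs)" and "Q = FQ (w # vs)"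
    have f: "is_frame n (krylov_list X w k) P Q" using frame[OF ex] by (simp add: kl P_def Q_def)
    obtain a B Y where a: "a \<in> carrier_vec k" and B: "B \<in> carrier_mat (n - k) k"
      and Y: "Y \<in> carrier_mat (n - k) (n - k)"
      and Z: "P * X * Q = four_block_mat (companion a) (0\<^sub>m k (n - k)) B Y"
      using krylov_normal_form[OF X w(1) k f zero[OF f]] by metis
    have ip: "inverse_pair n P Q" using f by (simp add: is_frame_def)
    hence P: "P \<in> carrier_mat n n" and Q: "Q \<in> carrier_mat n n" and QP: "Q * P = 1\<^sub>m n"
      by (auto simp: inverse_pair_def)
    have "Q * (P * X * Q) * P = (Q * P) * X * (Q * P)"
      using P Q X by (simp add: assoc_mult_mat[of _ n n _ n _ n])
    hence "X = Q * four_block_mat (companion a) (0\<^sub>m k (n - k)) B Y * P" using X by (simp add: QP Z)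
    hence XG: "X = G k (vs, Y, a, B)" by (simp only: G_def P_def Q_def prod.case)
    have "companion a \<in> carrier_mat k k" using companion_carrier[of a] carrier_vecD[OF a] by simp
    hence "char_poly X = companion_poly a * char_poly Y"
      using char_poly_four_block_upper_right_zero[OF _ B Y, of "companion a"] X
        inverse_pair_similar[OF ip X] Z by (simp add: char_poly_companion)
    hence "powerful_off (char_poly Y) (companion_poly a)"
      using powerful_off_factor pw by metis
    moreover have "vs \<in> L k" using krylov_carrier[OF X w(1)] by (auto simp: L_def vs_def)
    ultimately have "(vs, Y, a, B) \<in> D k" using a B Y by (simp add: D_def A_def)
    thus "X \<in> (\<Union>k\<in>{1..n}. G k ` D k)" using XG k by (intro UN_I[of k] image_eqI) auto
  qed
  have cD: "real (card (D k)) \<le> real ?q ^ (n * n - n) * b (n - k)" if k: "k \<in> {1..n}" for k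
  proof -
    have k': "1 \<le> k" "k \<le> n" using k by auto
    have cL: "card (L k) = ?q ^ (n * (k - 1))"
      unfolding L_def card_lists_length_eq[OF finite_carrier_vec] card_carrier_vec
      by (simp add: power_mult)
    have cA: "real (card (A k Y)) \<le> b (n - k)" if Y: "Y \<in> carrier_mat (n - k) (n - k)" for Y
    proof -
      have "char_poly Y \<in> monics (n - k)" using degree_monic_char_poly[OF Y] by (auto simp: monics_def)
      hence "real (powerful_count (n - (n - k)) (char_poly Y)) \<le> b (n - k)" using k' by (intro b) auto
      moreover have "n - (n - k) = k" using k' by simp
      ultimately show ?thesis using card_companion_le[of k "char_poly Y"] unfolding A_def by simp
    qed
    have "real (card (D k)) = real (card (L k)) *
        (\<Sum>Y\<in>carrier_mat (n - k) (n - k). real (card (A k Y)) * real (card (carrier_mat (n - k) k :: 'a mat set)))"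
      unfolding D_def card_cartesian_product
      by (subst card_SigmaI) (auto simp: finite_carrier_mat finA card_cartesian_product)
    also have "\<dots> \<le> real (card (L k)) *
        (\<Sum>Y\<in>(carrier_mat (n - k) (n - k) :: 'a mat set). b (n - k) * real (card (carrier_mat (n - k) k :: 'a mat set)))"
      using cA by (intro mult_left_mono sum_mono mult_right_mono) auto
    also have "\<dots> = real ?q ^ (n * (k - 1) + (n - k) * (n - k) + (n - k) * k) * b (n - k)"
      by (simp add: cL card_carrier_mat power_add)
    \<comment> \<open>\<open>Y\<close> and \<open>B\<close> together have \<open>(n - k) * n\<close>
      entries; with the \<open>n * (k - 1)\<close> entries of \<open>vs\<close> the exponent becomes
      independent of \<open>k\<close>.\<close>
    also have "n * (k - 1) + (n - k) * (n - k) + (n - k) * k = n * n - n"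
    proof -
      obtain i where i: "k = Suc i" using k' by (cases k) auto
      obtain j where j: "n = Suc i + j" using k' i le_Suc_ex by blast
      show ?thesis unfolding j i by (simp add: algebra_simps)
    qed
    finally show ?thesis .
  qed
  have "card {X \<in> carrier_mat n n. \<not> f_cyclic (X :: 'a mat)} \<le> card (\<Union>k\<in>{1..n}. G k ` D k)"
    by (rule card_mono[OF _ sub]) (simp add: finD)
  also have "\<dots> \<le> (\<Sum>k\<in>{1..n}. card (G k ` D k))" by (rule card_UN_le) simp
  also have "\<dots> \<le> (\<Sum>k\<in>{1..n}. card (D k))" by (intro sum_mono card_image_le finD)
  finally have "real (card {X \<in> carrier_mat n n. \<not> f_cyclic (X :: 'a mat)}) \<le> (\<Sum>k\<in>{1..n}. real (card (D k)))"
    by (simp only: of_nat_sum[symmetric] of_nat_le_iff)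
  also have "\<dots> \<le> (\<Sum>k\<in>{1..n}. real ?q ^ (n * n - n) * b (n - k))" by (intro sum_mono cD)
  also have "\<dots> = (\<Sum>j<n. real ?q ^ (n * n - n) * b j)"
    by (rule sum.reindex_bij_witness[of _ "\<lambda>j. n - j" "\<lambda>k. n - k"]) auto
  finally show ?thesis by (simp add: sum_distrib_left)
qed

text \<open>For \<open>2 \<le> n \<le> 7\<close> the terms \<open>j = 0, 1\<close> use
  \<open>powerful_bound\<close>, for \<open>8 \<le> n \<le> 16\<close> they use the square-root
  bound, and in both ranges the terms \<open>j \<ge> 2\<close> are trivial. From 17 on the
  square-root bound is used for all \<open>j\<close>.\<close>

lemma ex_powerful_count_bounds:
  assumes n: "n \<ge> 1"
  obtains b :: "nat \<Rightarrow> real" where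
    "\<And>j h. j < n \<Longrightarrow> h \<in> monics j \<Longrightarrow>
       real (powerful_count (n - j) (h :: 'a :: {finite, field} poly)) \<le> b j"
    "(\<Sum>j<n. b j) \<le> (983 / 1000) ^ n * real CARD('a) ^ n"
proof -
  let ?q = "CARD('a)"
  define y where "y = sqrt (real ?q)"
  have q: "?q \<ge> 2" using card_mono[of "UNIV :: 'a set" "{0, 1}"] by simp
  have y2: "y ^ 2 = real ?q" by (simp add: y_def)
  have y: "y \<ge> 1" using q by (simp add: y_def)
  have general: "real (powerful_count k h) \<le> 2 * y ^ k * (1 + 1 / y) ^ j"
    if "h \<in> monics j" for k j and h :: "'a poly"
  proof -
    have "h \<noteq> 0" "degree h = j" using that by (auto simp: monics_def)
    thus ?thesis using powerful_count_le[OF _ y y2, of h k] by simp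
  qed
  have trivial: "real (powerful_count k h) \<le> real ?q ^ k" for k and h :: "'a poly"
    using powerful_count_le_power[of k h] by (simp flip: of_nat_power)
  have split: "(\<Sum>j<n. if j = 0 then x else if j = 1 then z else real ?q ^ (n - j))
      = x + z + (\<Sum>j=2..<n. real ?q ^ (n - j))" if "n \<ge> 2" for x z :: real
  proof -
    have "{..<n} = insert 0 (insert 1 {2..<n})" using that by auto
    thus ?thesis by simp
  qed
  consider "n = 1" | "2 \<le> n" "n \<le> 7" | "8 \<le> n" "n \<le> 16" | "17 \<le> n" using n by linarith
  thus thesis
  proof cases
    case 1
    \<comment> \<open>No monic polynomial of degree one is powerful, so for \<open>n = 1\<close> the
      zero bound works.\<close>
    have "powerful_count 1 h \<le> 0" if "h \<in> monics 0" for h :: "'a poly"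
    proof -
      have "h = 1" using that monic_degree_0 by (auto simp: monics_def)
      thus ?thesis using powerful_count_one_le[where ?'a = 'a, of 1] by simp
    qed
    thus thesis using 1 by (intro that[of "\<lambda>_. 0"]) auto
  next
    case 2
    show thesis
    proof (rule that)
      fix j and h :: "'a poly" assume j: "j < n" "h \<in> monics j"
      show "real (powerful_count (n - j) h) \<le> (if j = 0 then real (powerful_bound ?q n) else
        if j = 1 then real (powerful_bound ?q (n - 1) + powerful_bound ?q (n - 2)) else real ?q ^ (n - j))"
      proof -
        consider "j = 0" | "j = 1" | "j \<ge> 2" by linarith
        thus ?thesis
        proof cases
          case 1
          hence "h = 1" using j monic_degree_0 by (auto simp: monics_def)
          thus ?thesis using 1 powerful_count_one_le[where ?'a = 'a, of n] by simp
        next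
          case 2
          have "n - 1 = Suc (n - 2)" using \<open>2 \<le> n\<close> by simp
          moreover have "monic h" "degree h = 1" using 2 j by (auto simp: monics_def)
          note powerful_count_degree_one_le[OF this, of "n - 2"]
          ultimately have "powerful_count (n - 1) h \<le> powerful_bound ?q (n - 1) + powerful_bound ?q (n - 2)"
            by simp
          hence "real (powerful_count (n - 1) h) \<le> real (powerful_bound ?q (n - 1) + powerful_bound ?q (n - 2))"
            by (simp only: of_nat_le_iff)
          thus ?thesis using 2 by simp
        qed (use trivial in auto)
      qed
    next
      show "(\<Sum>j<n. if j = 0 then real (powerful_bound ?q n) else
        if j = 1 then real (powerful_bound ?q (n - 1) + powerful_bound ?q (n - 2)) else real ?q ^ (n - j))
          \<le> (983 / 1000) ^ n * real ?q ^ n"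
        unfolding split[OF 2(1)] using small_dimension_bound[OF q 2] by simp
    qed
  next
    case 3
    hence n2: "n \<ge> 2" by simp
    show thesis
    proof (rule that)
      fix j and h :: "'a poly" assume j: "j < n" "h \<in> monics j"
      show "real (powerful_count (n - j) h) \<le> (if j = 0 then 2 * y ^ n else
        if j = 1 then 2 * y ^ (n - 1) * (1 + 1 / y) else real ?q ^ (n - j))"
        using general[OF j(2), of "n - j"] trivial[of "n - j" h] by auto
    next
      show "(\<Sum>j<n. if j = 0 then 2 * y ^ n else
        if j = 1 then 2 * y ^ (n - 1) * (1 + 1 / y) else real ?q ^ (n - j)) \<le> (983 / 1000) ^ n * real ?q ^ n"
        unfolding split[OF n2] using medium_dimension_bound[of y n] 3 y q by (simp add: y2)
    qed
  next
    case 4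
    show thesis
    proof (rule that)
      fix j and h :: "'a poly" assume "j < n" "h \<in> monics j"
      thus "real (powerful_count (n - j) h) \<le> 2 * y ^ (n - j) * (1 + 1 / y) ^ j" by (intro general)
    next
      show "(\<Sum>j<n. 2 * y ^ (n - j) * (1 + 1 / y) ^ j) \<le> (983 / 1000) ^ n * real ?q ^ n"
        using large_dimension_bound[of y n] 4 y q by (simp add: y2)
    qed
  qed
qed

theorem theorem1p1:
  fixes n :: nat
  assumes "n \<ge> 1"
  shows "real (card {X \<in> carrier_mat n n. f_cyclic (X :: 'a :: {finite, field} mat)})
           / real (card (carrier_mat n n :: 'a mat set))
         \<ge> 1 - (983 / 1000 :: real) ^ n"
proof -
  let ?q = "real CARD('a)" and ?M = "carrier_mat n n :: 'a mat set"
  let ?U = "{X \<in> ?M. \<not> f_cyclic X}" and ?C = "{X \<in> ?M. f_cyclic X}"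
  have q: "?q > 0" by simp
  obtain b :: "nat \<Rightarrow> real" where b: "\<And>j h. j < n \<Longrightarrow> h \<in> monics j \<Longrightarrow>
       real (powerful_count (n - j) (h :: 'a poly)) \<le> b j"
    and sum: "(\<Sum>j<n. b j) \<le> (983 / 1000) ^ n * ?q ^ n"
    using ex_powerful_count_bounds[OF assms, where ?'a = 'a] by blast
  have "real (card ?U) \<le> ?q ^ (n * n - n) * (\<Sum>j<n. b j)"
    by (rule card_not_f_cyclic_le[OF assms b])
  also have "\<dots> \<le> ?q ^ (n * n - n) * ((983 / 1000) ^ n * ?q ^ n)"
    using sum by (intro mult_left_mono) auto
  also have "\<dots> = (983 / 1000) ^ n * ?q ^ (n * n - n + n)" by (simp only: power_add mult_ac)
  \<comment> \<open>The exponent \<open>n * n\<close> turns the bound into a proportion of all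
    matrices.\<close>
  also have "n * n - n + n = n * n" using assms by simp
  finally have U: "real (card ?U) \<le> (983 / 1000) ^ n * real (card ?M)" by (simp add: card_carrier_mat)
  have "?M = ?C \<union> ?U" "?C \<inter> ?U = {}" by auto
  hence "card ?M = card ?C + card ?U"
    by (metis (no_types, lifting) card_Un_disjoint finite_Un finite_carrier_mat)
  hence "real (card ?C) \<ge> (1 - (983 / 1000) ^ n) * real (card ?M)" using U by (simp add: algebra_simps)
  moreover have "real (card ?M) > 0" using q by (simp add: card_carrier_mat)
  ultimately show ?thesis by (simp add: pos_le_divide_eq)
qed

end
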